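(* Given deterministic regex $\alpha,\beta$, it is undecidable whether $\mathcal{L}(\alpha)\cap\mathcal{L}(\beta)=\emptyset$.
   Context: Regex. Let $\Sigma$ be a finite terminal alphabet ($|\Sigma|\ge 2$ unless otherwise noted) and $\Xi$ an infinite variable alphabet disjoint from $\Sigma$. The set $\mathsf{RX}$ of regex, with $\mathsf{var}(\alpha)\subset\Xi$ the set of variables occurring in $\alpha$, is defined recursively: every $a\in\Sigma\cup\{\varepsilon\}$ is a regex; $\&x$ (variable reference) for $x\in\Xi$; $(\alpha\cdot\beta)$, $(\alpha\vee\beta)$, $(\alpha^+)$ for $\alpha,\beta\in\mathsf{RX}$; and $\langle x:\alpha\rangle$ (variable binding) for $\alpha\in\mathsf{RX}$ and $x\in\Xi\setminus\mathsf{var}(\alpha)$. Also $\emptyset$ is a regex, but may not occur inside another regex. $\alpha^*$ abbreviates $\varepsilon\vee\alpha^+$; a nonempty set $A\subseteq\Sigma$ abbreviates $\bigvee_{a\in A}a$. Let $\Gamma=\{[_x,]_x\mid x\in\Xi\}$. The ref-language $\mathcal{R}(\alpha)\subseteq(\Sigma\cup\Xi\cup\Gamma)^*$ is given by $\mathcal{R}(\emptyset)=\emptyset$, $\mathcal{R}(a)=\{a\}$ for $a\in\Sigma\cup\{\varepsilon\}$, $\mathcal{R}(\&x)=\{x\}$, $\mathcal{R}(\langle x:\alpha\rangle)=[_x\mathcal{R}(\alpha)]_x$, $\mathcal{R}(\alpha\cdot\beta)=\mathcal{R}(\alpha)\mathcal{R}(\beta)$, $\mathcal{R}(\alpha\vee\beta)=\mathcal{R}(\alpha)\cup\mathcal{R}(\beta)$,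 $\mathcal{R}(\alpha^+)=\mathcal{R}(\alpha)^+$. For $r\in\mathcal{R}(\alpha)$, the dereference $\mathcal{D}(r)\in\Sigma^*$ is obtained by replacing each occurrence of a variable $x$ by $v$, where $[_x v]_x$ is the nearest such factor to the left of this occurrence (or by $\varepsilon$ if there is none; variables inside $v$ are replaced likewise), and then deleting all symbols of $\Gamma$. $\mathcal{L}(\alpha)=\{\mathcal{D}(r)\mid r\in\mathcal{R}(\alpha)\}$. Deterministic regex. Let $\alpha_{\mathcal{R}}$ be the regular expression over $\Sigma\cup\Xi\cup\Gamma$ obtained from $\alpha$ by replacing each $\langle x:\beta\rangle$ by $[_x\beta_{\mathcal{R}}]_x$ and each $\&x$ by $x$. The marked regex $\tilde\alpha$ is obtained from $\alpha_{\mathcal{R}}$ by attaching to each occurrence of a symbol $\chi\in\Sigma\cup\Xi\cup\Gamma$ its own unique number $i$, written $\chi_{(i)}$; $\mathcal{R}(\tilde\alpha)$ is the language of marked ref-words it generates. $\tilde A$ denotes the set of marked symbols from $A$. A regex $\alpha$ is not deterministic if there exist $\rho_1,\rho_2\in\mathcal{R}(\tilde\alpha)$, $r,s_1,s_2\in(\tilde\Sigma\cup\tilde\Xi\cup\tilde\Gamma)^*$ and $\gamma_1,\gamma_2\in\tilde\Gamma^*$ such that one of the following holds: (1) $\rho_1=r\gamma_1a_{(i)}s_1$ and $\rho_2=r\gamma_2a_{(j)}s_2$ with $a\in\Sigma$, $i\ne j$; (2) $\rho_1=r\gamma_1x_{(i)}s_1$ and $\rho_2=r\gamma_2\chi_{(j)}s_2$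 with $x\in\Xi$, $\chi\in\Sigma\cup\Xi$, $i\neq j$; (3) $\rho_1=r\gamma_1\chi_{(i)}s_1$ and $\rho_2=r\gamma_2\chi_{(i)}s_2$ with $\chi\in\Sigma\cup\Xi$, $\gamma_1\ne\gamma_2$; (4) $\rho_1=r\gamma_1$ and $\rho_2=r\gamma_2$ with $\gamma_1\neq\gamma_2$. Otherwise $\alpha$ is deterministic. *)

theory Defs
  imports "HOL-Library.Nat_Bijection" "HOL-Library.Cardinality"
begin

section \<open>Regex with variables\<close>

text \<open>
  The terminal alphabet is the type \<^typ>\<open>'a\<close>, the variable alphabet the type \<^typ>\<open>'x\<close>.
  The datatype contains raw expressions; the two side conditions (no variable is bound around one
  of its own occurrences, and the empty-set expression is not a proper subexpression) are imposed
  by \<open>is_regex\<close> below.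
\<close>

datatype ('a, 'x) regex =
    Empty
  | Eps
  | Sym 'a
  | Ref 'x
  | Cat "('a, 'x) regex" "('a, 'x) regex"
  | Alt "('a, 'x) regex" "('a, 'x) regex"
  | Plus "('a, 'x) regex"
  | Bind 'x "('a, 'x) regex"

primrec var :: "('a, 'x) regex \<Rightarrow> 'x set" where
  "var Empty = {}"
| "var Eps = {}"
| "var (Sym a) = {}"
| "var (Ref x) = {x}"
| "var (Cat \<alpha> \<beta>) = var \<alpha> \<union> var \<beta>"
| "var (Alt \<alpha> \<beta>) = var \<alpha> \<union> var \<beta>"
| "var (Plus \<alpha>) = var \<alpha>"
| "var (Bind x \<alpha>) = insert x (var \<alpha>)"

primrec is_nonempty_regex :: "('a, 'x) regex \<Rightarrow> bool" where
  "is_nonempty_regex Empty \<longleftrightarrow> False"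
| "is_nonempty_regex Eps \<longleftrightarrow> True"
| "is_nonempty_regex (Sym a) \<longleftrightarrow> True"
| "is_nonempty_regex (Ref x) \<longleftrightarrow> True"
| "is_nonempty_regex (Cat \<alpha> \<beta>) \<longleftrightarrow> is_nonempty_regex \<alpha> \<and> is_nonempty_regex \<beta>"
| "is_nonempty_regex (Alt \<alpha> \<beta>) \<longleftrightarrow> is_nonempty_regex \<alpha> \<and> is_nonempty_regex \<beta>"
| "is_nonempty_regex (Plus \<alpha>) \<longleftrightarrow> is_nonempty_regex \<alpha>"
| "is_nonempty_regex (Bind x \<alpha>) \<longleftrightarrow> is_nonempty_regex \<alpha> \<and> x \<notin> var \<alpha>"

definition is_regex :: "('a, 'x) regex \<Rightarrow> bool" where
  "is_regex \<alpha> \<longleftrightarrow> \<alpha> = Empty \<or> is_nonempty_regex \<alpha>"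


section \<open>Ref-words and the language of a regex\<close>

text \<open>\<open>Opn x\<close> and \<open>Cls x\<close> are the brackets \<open>[\<^sub>x\<close> and \<open>]\<^sub>x\<close>.\<close>

datatype ('a, 'x) rsym = Tm 'a | Var 'x | Opn 'x | Cls 'x

primrec is_bracket :: "('a, 'x) rsym \<Rightarrow> bool" where
  "is_bracket (Tm a) \<longleftrightarrow> False"
| "is_bracket (Var x) \<longleftrightarrow> False"
| "is_bracket (Opn x) \<longleftrightarrow> True"
| "is_bracket (Cls x) \<longleftrightarrow> True"

definition conc :: "'s list set \<Rightarrow> 's list set \<Rightarrow> 's list set" where
  "conc A B = {u @ v | u v. u \<in> A \<and> v \<in> B}"

definition lang_plus :: "'s list set \<Rightarrow> 's list set" where
  "lang_plus A = {concat ws | ws. ws \<noteq> [] \<and> set ws \<subseteq> A}"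

primrec reflang :: "('a, 'x) regex \<Rightarrow> ('a, 'x) rsym list set" where
  "reflang Empty = {}"
| "reflang Eps = {[]}"
| "reflang (Sym a) = {[Tm a]}"
| "reflang (Ref x) = {[Var x]}"
| "reflang (Cat \<alpha> \<beta>) = conc (reflang \<alpha>) (reflang \<beta>)"
| "reflang (Alt \<alpha> \<beta>) = reflang \<alpha> \<union> reflang \<beta>"
| "reflang (Plus \<alpha>) = lang_plus (reflang \<alpha>)"
| "reflang (Bind x \<alpha>) = conc {[Opn x]} (conc (reflang \<alpha>) {[Cls x]})"

text \<open>The largest position before \<open>i\<close> at which \<open>r\<close> carries the symbol \<open>s\<close>.\<close>

definition last_before :: "'s list \<Rightarrow> nat \<Rightarrow> 's \<Rightarrow> nat option" where
  "last_before r i s =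
     (if \<exists>k<i. r ! k = s then Some (GREATEST k. k < i \<and> r ! k = s) else None)"

lemma last_before_less: "last_before r i s = Some k \<Longrightarrow> k < i"
  unfolding last_before_def
  by (auto split: if_splits)
    (metis (mono_tags, lifting) GreatestI_nat less_imp_le_nat)

text \<open>
  \<open>deref_at r i\<close> is the terminal word that replaces the symbol at position \<open>i\<close> of \<open>r\<close>.  For an
  occurrence of a variable \<open>x\<close>, the nearest factor \<open>[\<^sub>x v ]\<^sub>x\<close> to its left ends with the last
  \<open>]\<^sub>x\<close> before that occurrence (at \<open>k\<close>) and starts with the last \<open>[\<^sub>x\<close> before \<open>k\<close> (at \<open>j\<close>), since
  in ref-words of a regex the brackets of one variable are never nested.  Variables inside \<open>v\<close> are
  dereferenced at the position where they occur in \<open>v\<close>.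
\<close>

function deref_at :: "('a, 'x) rsym list \<Rightarrow> nat \<Rightarrow> 'a list" where
  "deref_at r i =
     (case r ! i of
        Tm a \<Rightarrow> [a]
      | Opn x \<Rightarrow> []
      | Cls x \<Rightarrow> []
      | Var x \<Rightarrow>
          (case last_before r i (Cls x) of
             None \<Rightarrow> []
           | Some k \<Rightarrow>
               (case last_before r k (Opn x) of
                  None \<Rightarrow> []
                | Some j \<Rightarrow> concat (map (deref_at r) [Suc j..<k]))))"
  by pat_completeness auto
termination
  by (relation "measure snd") (auto dest!: last_before_less)

declare deref_at.simps [simp del]

definition deref :: "('a, 'x) rsym list \<Rightarrow> 'a list" where
  "deref r = concat (map (deref_at r) [0..<length r])"

definition lang :: "('a, 'x) regex \<Rightarrow> 'a list set" where
  "lang \<alpha> = deref ` reflang \<alpha>"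


section \<open>Deterministic regex\<close>

text \<open>Plain regular expressions over an arbitrary alphabet.\<close>

datatype 's rexp =
    RZero
  | ROne
  | RAtom 's
  | RCat "'s rexp" "'s rexp"
  | RAlt "'s rexp" "'s rexp"
  | RPlus "'s rexp"

primrec rexp_lang :: "'s rexp \<Rightarrow> 's list set" where
  "rexp_lang RZero = {}"
| "rexp_lang ROne = {[]}"
| "rexp_lang (RAtom s) = {[s]}"
| "rexp_lang (RCat e f) = conc (rexp_lang e) (rexp_lang f)"
| "rexp_lang (RAlt e f) = rexp_lang e \<union> rexp_lang f"
| "rexp_lang (RPlus e) = lang_plus (rexp_lang e)"

primrec to_rexp :: "('a, 'x) regex \<Rightarrow> ('a, 'x) rsym rexp" where
  "to_rexp Empty = RZero"
| "to_rexp Eps = ROne"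
| "to_rexp (Sym a) = RAtom (Tm a)"
| "to_rexp (Ref x) = RAtom (Var x)"
| "to_rexp (Cat \<alpha> \<beta>) = RCat (to_rexp \<alpha>) (to_rexp \<beta>)"
| "to_rexp (Alt \<alpha> \<beta>) = RAlt (to_rexp \<alpha>) (to_rexp \<beta>)"
| "to_rexp (Plus \<alpha>) = RPlus (to_rexp \<alpha>)"
| "to_rexp (Bind x \<alpha>) = RCat (RAtom (Opn x)) (RCat (to_rexp \<alpha>) (RAtom (Cls x)))"

lemma rexp_lang_to_rexp: "rexp_lang (to_rexp \<alpha>) = reflang \<alpha>"
  by (induction \<alpha>) simp_all

text \<open>
  \<open>mark_from n e\<close> numbers the symbol occurrences of \<open>e\<close> from left to right, starting with \<open>n\<close>, and
  also returns the first unused number.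
\<close>

primrec mark_from :: "nat \<Rightarrow> 's rexp \<Rightarrow> ('s \<times> nat) rexp \<times> nat" where
  "mark_from n RZero = (RZero, n)"
| "mark_from n ROne = (ROne, n)"
| "mark_from n (RAtom s) = (RAtom (s, n), Suc n)"
| "mark_from n (RCat e f) =
     (let (e', m) = mark_from n e; (f', k) = mark_from m f in (RCat e' f', k))"
| "mark_from n (RAlt e f) =
     (let (e', m) = mark_from n e; (f', k) = mark_from m f in (RAlt e' f', k))"
| "mark_from n (RPlus e) = (let (e', m) = mark_from n e in (RPlus e', m))"

definition marked_reflang :: "('a, 'x) regex \<Rightarrow> (('a, 'x) rsym \<times> nat) list set" where
  "marked_reflang \<alpha> = rexp_lang (fst (mark_from 0 (to_rexp \<alpha>)))"

definition marked_brackets :: "(('a, 'x) rsym \<times> nat) list \<Rightarrow> bool" where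
  "marked_brackets \<gamma> \<longleftrightarrow> (\<forall>s\<in>set \<gamma>. is_bracket (fst s))"

definition nondeterministic :: "('a, 'x) regex \<Rightarrow> bool" where
  "nondeterministic \<alpha> \<longleftrightarrow>
     (\<exists>\<rho>\<^sub>1\<in>marked_reflang \<alpha>. \<exists>\<rho>\<^sub>2\<in>marked_reflang \<alpha>. \<exists>r s\<^sub>1 s\<^sub>2 \<gamma>\<^sub>1 \<gamma>\<^sub>2.
        marked_brackets \<gamma>\<^sub>1 \<and> marked_brackets \<gamma>\<^sub>2 \<and>
        ((\<exists>a i j. \<rho>\<^sub>1 = r @ \<gamma>\<^sub>1 @ [(Tm a, i)] @ s\<^sub>1 \<and> \<rho>\<^sub>2 = r @ \<gamma>\<^sub>2 @ [(Tm a, j)] @ s\<^sub>2 \<and> i \<noteq> j) \<or>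
         (\<exists>x \<chi> i j. \<not> is_bracket \<chi> \<and>
            \<rho>\<^sub>1 = r @ \<gamma>\<^sub>1 @ [(Var x, i)] @ s\<^sub>1 \<and> \<rho>\<^sub>2 = r @ \<gamma>\<^sub>2 @ [(\<chi>, j)] @ s\<^sub>2 \<and> i \<noteq> j) \<or>
         (\<exists>\<chi> i. \<not> is_bracket \<chi> \<and>
            \<rho>\<^sub>1 = r @ \<gamma>\<^sub>1 @ [(\<chi>, i)] @ s\<^sub>1 \<and> \<rho>\<^sub>2 = r @ \<gamma>\<^sub>2 @ [(\<chi>, i)] @ s\<^sub>2 \<and> \<gamma>\<^sub>1 \<noteq> \<gamma>\<^sub>2) \<or>
         (\<rho>\<^sub>1 = r @ \<gamma>\<^sub>1 \<and> \<rho>\<^sub>2 = r @ \<gamma>\<^sub>2 \<and> \<gamma>\<^sub>1 \<noteq> \<gamma>\<^sub>2)))"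

definition deterministic_regex :: "('a, 'x) regex \<Rightarrow> bool" where
  "deterministic_regex \<alpha> \<longleftrightarrow> is_regex \<alpha> \<and> \<not> nondeterministic \<alpha>"


section \<open>Decidability\<close>

text \<open>
  Partial recursive functions.  \<open>computes f xs y\<close> means that \<open>f\<close> is defined on the argument list
  \<open>xs\<close>, with value \<open>y\<close>.  Arities are not tracked: an application that does not fit has no value.
\<close>

datatype recf =
    Zero
  | Succ
  | Proj nat
  | Comp recf "recf list"
  | Prec recf recf
  | Mu recf

inductive computes :: "recf \<Rightarrow> nat list \<Rightarrow> nat \<Rightarrow> bool" where
  zero: "computes Zero xs 0"
| succ: "computes Succ [x] (Suc x)"
| proj: "i < length xs \<Longrightarrow> computes (Proj i) xs (xs ! i)"
| comp: "list_all2 (\<lambda>g y. computes g xs y) gs ys \<Longrightarrow> computes f ys z \<Longrightarrow>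
    computes (Comp f gs) xs z"
| prec_0: "computes f xs y \<Longrightarrow> computes (Prec f g) (0 # xs) y"
| prec_Suc: "computes (Prec f g) (n # xs) y \<Longrightarrow> computes g (n # y # xs) z \<Longrightarrow>
    computes (Prec f g) (Suc n # xs) z"
| mu: "computes f (n # xs) 0 \<Longrightarrow> (\<And>m. m < n \<Longrightarrow> \<exists>k. computes f (m # xs) (Suc k)) \<Longrightarrow>
    computes (Mu f) xs n"

lemma computes_functional: "computes f xs y \<Longrightarrow> computes f xs z \<Longrightarrow> y = z"
proof (induction arbitrary: z rule: computes.induct)
  case (zero xs)
  then show ?case by (auto elim: computes.cases)
next
  case (succ x)
  then show ?case by (auto elim: computes.cases)
next
  case (proj i xs)
  then show ?case by (auto elim: computes.cases)
next
  case (comp xs gs ys f y)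
  from comp.prems obtain ys' where
    ys': "list_all2 (\<lambda>g y. computes g xs y) gs ys'" "computes f ys' z"
    by (auto elim: computes.cases)
  have "ys = ys'"
    using comp.IH(1) ys'(1) by (auto simp: list_all2_conv_all_nth intro!: nth_equalityI)
  with comp.IH(2) ys'(2) show ?case by simp
next
  case (prec_0 f xs y g)
  from prec_0.prems have "computes f xs z" by (auto elim: computes.cases)
  then show ?case by (rule prec_0.IH)
next
  case (prec_Suc f g n xs y w)
  from prec_Suc.prems obtain y' where "computes (Prec f g) (n # xs) y'" "computes g (n # y' # xs) z"
    by (auto elim: computes.cases)
  with prec_Suc.IH show ?case by blast
next
  case (mu f n xs)
  from mu.prems have z: "computes f (z # xs) 0" "\<And>m. m < z \<Longrightarrow> \<exists>k. computes f (m # xs) (Suc k)"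
    by (auto elim: computes.cases)
  show ?case
  proof (rule linorder_cases[of n z])
    assume "n < z"
    with z(2) mu.IH(1) show ?thesis by blast
  next
    assume "z < n"
    with z(1) mu.IH(2) show ?thesis by blast
  qed
qed

text \<open>
  The property \<open>P\<close> of the instances in \<open>I\<close>, given to the procedure in the encoding \<open>enc\<close>, is
  decidable.  No requirement is made about arguments that do not encode an element of \<open>I\<close>: the
  procedure may even diverge on them.
\<close>

definition decidable_on :: "'i set \<Rightarrow> ('i \<Rightarrow> nat list) \<Rightarrow> ('i \<Rightarrow> bool) \<Rightarrow> bool" where
  "decidable_on I enc P \<longleftrightarrow> (\<exists>f. \<forall>w\<in>I. computes f (enc w) (if P w then 1 else 0))"

text \<open>The Goedel number of a regex, relative to a numbering \<open>cd\<close> of the terminal symbols.\<close>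

primrec regex_code :: "('a \<Rightarrow> nat) \<Rightarrow> ('a, nat) regex \<Rightarrow> nat" where
  "regex_code cd Empty = prod_encode (0, 0)"
| "regex_code cd Eps = prod_encode (1, 0)"
| "regex_code cd (Sym a) = prod_encode (2, cd a)"
| "regex_code cd (Ref x) = prod_encode (3, x)"
| "regex_code cd (Cat \<alpha> \<beta>) = prod_encode (4, prod_encode (regex_code cd \<alpha>, regex_code cd \<beta>))"
| "regex_code cd (Alt \<alpha> \<beta>) = prod_encode (5, prod_encode (regex_code cd \<alpha>, regex_code cd \<beta>))"
| "regex_code cd (Plus \<alpha>) = prod_encode (6, regex_code cd \<alpha>)"
| "regex_code cd (Bind x \<alpha>) = prod_encode (7, prod_encode (x, regex_code cd \<alpha>))"

lemma inj_regex_code: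
  assumes "inj cd"
  shows "inj (regex_code cd)"
proof (rule injI)
  fix \<alpha> \<beta> :: "('a, nat) regex"
  assume "regex_code cd \<alpha> = regex_code cd \<beta>"
  then show "\<alpha> = \<beta>"
  proof (induction \<alpha> arbitrary: \<beta>)
    case Empty then show ?case by (cases \<beta>) auto
  next
    case Eps then show ?case by (cases \<beta>) auto
  next
    case (Sym a) then show ?case by (cases \<beta>) (auto dest: injD[OF assms])
  next
    case (Ref x) then show ?case by (cases \<beta>) auto
  next
    case (Cat \<alpha>1 \<alpha>2) then show ?case by (cases \<beta>) auto
  next
    case (Alt \<alpha>1 \<alpha>2) then show ?case by (cases \<beta>) auto
  next
    case (Plus \<alpha>) then show ?case by (cases \<beta>) auto
  next
    case (Bind x \<alpha>) then show ?case by (cases \<beta>) auto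
  qed
qed

definition regex_pair_code ::
    "('a \<Rightarrow> nat) \<Rightarrow> ('a, nat) regex \<times> ('a, nat) regex \<Rightarrow> nat list" where
  "regex_pair_code cd = (\<lambda>(\<alpha>, \<beta>). [regex_code cd \<alpha>, regex_code cd \<beta>])"

end

theory Submission
  imports Defs
begin

text \<open>
  A register machine is simulated by variables: one regex \<open>\<alpha>\<close>, built along the structure of a while
  program, emits every value that the program writes and guesses the result of every decrement; the
  guesses are checked by a fixed regex \<open>\<beta>\<close>, which only compares neighbouring blocks of the trace.
  The two languages meet iff the program halts.  Both regex are deterministic since their words only
  part at two different terminals.  As the input is plugged into \<open>\<alpha>\<close> as a prefix whose number is
  easily computed, no universal function is needed: a program is run on the number of its own regex.
\<close>

section \<open>Dereferencing from left to right\<close>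

text \<open>The obstacle is subtraction. A binding can copy a value or put a letter in front of it,
  so zero, copies and successors are written outright; but no reference strips a letter, and the
  choice of a ref-word never depends on the values, so \<open>\<alpha>\<close> can neither compute a
  predecessor nor verify one. Hence the guess, and hence the intersection: \<open>\<beta>\<close>
  can bind an arbitrary block and demand a second copy of it. The letter \<open>b\<close> closing
  every number makes the code prefix-free. A trace is therefore cut into records in only one way,
  and a deterministic star knows where to stop. Structured programs are used because a regex has
  nested iteration but no jumps. In the diagonal argument the input \<open>n\<close> occurs twice in
  the number of the combined regex: through the numeral, which is handled by primitive recursion,
  and literally, as the number of the second operand of the outermost \<open>Cat\<close>. So
  \<open>n\<close> never has to be decoded.\<close>

lemma last_before_cong:
  assumes "\<And>k. k < i \<Longrightarrow> r ! k = r' ! k"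
  shows "last_before r i s = last_before r' i s"
proof -
  have "(k < i \<and> r ! k = s) = (k < i \<and> r' ! k = s)" for k
    using assms by auto
  then show ?thesis
    by (simp add: last_before_def)
qed

lemma last_before_append: "i \<le> length u \<Longrightarrow> last_before (u @ v) i s = last_before u i s"
  by (rule last_before_cong) (simp add: nth_append)

lemma last_before_snoc:
  "last_before (u @ [t]) (Suc (length u)) s =
     (if t = s then Some (length u) else last_before u (length u) s)"
proof (cases "t = s")
  case True
  have "(GREATEST k. k < Suc (length u) \<and> (u @ [t]) ! k = s) = length u"
    by (rule Greatest_equality) (use True in auto)
  then show ?thesis
    using True by (auto simp: last_before_def)
next
  case False
  have "k < Suc (length u) \<and> (u @ [t]) ! k = s \<longleftrightarrow> k < length u \<and> u ! k = s" for k
    using False by (auto simp: nth_append less_Suc_eq)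
  then show ?thesis
    using False by (simp add: last_before_def)
qed

lemma last_before_nth: "last_before r i s = Some k \<Longrightarrow> r ! k = s"
  unfolding last_before_def
  by (auto split: if_splits)
    (metis (mono_tags, lifting) GreatestI_nat less_imp_le_nat)

text \<open>The variable case of \<open>deref_at\<close>, detached from the symbol at position
  \<open>i\<close>. As a function of \<open>x\<close> it is the environment reached there.\<close>

definition value_at :: "('a, 'x) rsym list \<Rightarrow> nat \<Rightarrow> 'x \<Rightarrow> 'a list" where
  "value_at r i x =
    (case last_before r i (Cls x) of
       None \<Rightarrow> []
     | Some k \<Rightarrow>
         (case last_before r k (Opn x) of
            None \<Rightarrow> []
          | Some j \<Rightarrow> concat (map (deref_at r) [Suc j..<k])))"

lemma deref_at_altdef:
  "deref_at r i = (case r ! i of Tm a \<Rightarrow> [a] | Var x \<Rightarrow> value_at r i x | _ \<Rightarrow> [])"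
  by (subst deref_at.simps) (simp add: value_at_def split: rsym.split)

lemma value_at_append_aux:
  assumes "\<And>k. k < i \<Longrightarrow> deref_at (u @ v) k = deref_at u k" "i \<le> length u"
  shows "value_at (u @ v) i x = value_at u i x"
proof (cases "last_before u i (Cls x)")
  case None
  with assms(2) show ?thesis
    by (simp add: value_at_def last_before_append)
next
  case (Some k)
  then have "k < i"
    by (rule last_before_less)
  then have "map (deref_at (u @ v)) [Suc j..<k] = map (deref_at u) [Suc j..<k]" for j
    using assms(1) by (intro map_cong) auto
  then show ?thesis
    using Some assms(2) \<open>k < i\<close>
    by (simp add: value_at_def last_before_append del: map_eq_conv split: option.split)
qed

lemma deref_at_append: "i < length u \<Longrightarrow> deref_at (u @ v) i = deref_at u i"
proof (induction i rule: less_induct)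
  case (less i)
  then have "value_at (u @ v) i x = value_at u i x" for x
    by (intro value_at_append_aux) auto
  with less.prems show ?case
    by (simp add: deref_at_altdef nth_append split: rsym.split)
qed

lemma value_at_append: "i \<le> length u \<Longrightarrow> value_at (u @ v) i x = value_at u i x"
  by (rule value_at_append_aux) (auto simp: deref_at_append)

lemma concat_deref_at_append:
  assumes "k \<le> length u"
  shows "concat (map (deref_at (u @ v)) [i..<k]) = concat (map (deref_at u) [i..<k])"
proof -
  have "map (deref_at (u @ v)) [i..<k] = map (deref_at u) [i..<k]"
    using assms by (intro map_cong) (auto simp: deref_at_append)
  then show ?thesis
    by (rule arg_cong)
qed

lemma deref_snoc:
  "deref (u @ [t]) = deref u @ (case t of Tm a \<Rightarrow> [a] | Var x \<Rightarrow> value_at u (length u) x | _ \<Rightarrow> [])"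
proof -
  have "deref_at (u @ [t]) (length u) =
      (case t of Tm a \<Rightarrow> [a] | Var x \<Rightarrow> value_at u (length u) x | _ \<Rightarrow> [])"
    by (simp add: deref_at_altdef value_at_append split: rsym.split)
  then show ?thesis
    by (simp add: deref_def concat_deref_at_append)
qed

text \<open>A position contributes the same output in \<open>r\<close> as in a prefix containing it,
  and the bracket at \<open>j\<close> contributes nothing, so the content of a factor is what the
  output gained between two prefixes. This is why remembering an output position suffices for an
  open bracket.\<close>

lemma deref_at_between:
  assumes "r ! j = Opn x" "j < k" "k \<le> length r"
  shows "concat (map (deref_at r) [Suc j..<k]) = drop (length (deref (take j r))) (deref (take k r))"
proof -
  have pre: "deref (take i r) = concat (map (deref_at r) [0..<i])" if "i \<le> length r" for i
  proof -
    have "concat (map (deref_at (take i r @ drop i r)) [0..<i]) = concat (map (deref_at (take i r)) [0..<i])"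
      by (rule concat_deref_at_append) (use that in simp)
    moreover have "length (take i r) = i"
      using that by simp
    ultimately show ?thesis
      by (simp only: deref_def append_take_drop_id)
  qed
  have "[0..<k] = [0..<j] @ [j..<k]"
    using assms(2) upt_add_eq_append[of 0 j "k - j"] by simp
  also have "[j..<k] = j # [Suc j..<k]"
    using assms(2) by (rule upt_conv_Cons)
  finally have upt: "[0..<k] = [0..<j] @ j # [Suc j..<k]" .
  have "deref_at r j = []"
    using assms(1) by (simp add: deref_at_altdef)
  then have "deref (take k r) = deref (take j r) @ concat (map (deref_at r) [Suc j..<k])"
    using assms(2,3) unfolding pre[OF assms(3)] upt by (simp add: pre)
  then show ?thesis
    by simp
qed

type_synonym ('a, 'x) dstate = "('x \<Rightarrow> 'a list) \<times> ('x \<Rightarrow> nat option) \<times> 'a list"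

text \<open>
  A state holds the current values of the variables, the output position at which the last
  \<open>[\<^sub>x\<close> was read, and the output.
\<close>

fun dstep :: "('a, 'x) rsym \<Rightarrow> ('a, 'x) dstate \<Rightarrow> ('a, 'x) dstate" where
  "dstep (Tm a) (\<rho>, p, w) = (\<rho>, p, w @ [a])"
| "dstep (Var x) (\<rho>, p, w) = (\<rho>, p, w @ \<rho> x)"
| "dstep (Opn x) (\<rho>, p, w) = (\<rho>, p(x := Some (length w)), w)"
| "dstep (Cls x) (\<rho>, p, w) = (\<rho>(x := (case p x of None \<Rightarrow> [] | Some n \<Rightarrow> drop n w)), p, w)"

definition opened_at :: "('a, 'x) rsym list \<Rightarrow> 'x \<Rightarrow> nat option" where
  "opened_at u x =
     map_option (\<lambda>j. length (deref (take j u))) (last_before u (length u) (Opn x))"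

lemma value_at_snoc:
  "value_at (u @ [t]) (Suc (length u)) x =
    (if t = Cls x then
       (case opened_at u x of None \<Rightarrow> [] | Some n \<Rightarrow> drop n (deref u))
     else value_at u (length u) x)"
proof (cases "t = Cls x")
  case True
  show ?thesis
  proof (cases "last_before u (length u) (Opn x)")
    case None
    with True show ?thesis
      by (simp add: value_at_def last_before_snoc last_before_append opened_at_def)
  next
    case (Some j)
    then have "concat (map (deref_at u) [Suc j..<length u]) = drop (length (deref (take j u))) (deref u)"
      using last_before_less[OF Some] last_before_nth[OF Some] deref_at_between[of u j x "length u"]
      by simp
    with True Some show ?thesis
      by (simp add: value_at_def last_before_snoc last_before_append opened_at_def
          concat_deref_at_append)
  qed
next
  case False
  show ?thesis
  proof (cases "last_before u (length u) (Cls x)")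
    case None
    with False show ?thesis
      by (simp add: value_at_def last_before_snoc)
  next
    case (Some k)
    with last_before_less[OF Some] False show ?thesis
      by (simp add: value_at_def last_before_snoc last_before_append concat_deref_at_append
          split: option.split)
  qed
qed

lemma opened_at_snoc:
  "opened_at (u @ [t]) x = (if t = Opn x then Some (length (deref u)) else opened_at u x)"
proof (cases "last_before u (length u) (Opn x)")
  case (Some j)
  with last_before_less[OF Some] show ?thesis
    by (simp add: opened_at_def last_before_snoc)
qed (simp add: opened_at_def last_before_snoc)

text \<open>The bridge from the semantics that looks back to a machine that reads once. From here on
  words are evaluated by \<open>fold dstep\<close> only.\<close>

lemma fold_dstep:
  "fold dstep u (\<lambda>_. [], \<lambda>_. None, []) = (value_at u (length u), opened_at u, deref u)"
proof (induction u rule: rev_induct)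
  case Nil
  show ?case
    by (simp add: value_at_def opened_at_def last_before_def deref_def)
next
  case (snoc t u)
  then show ?case
    by (cases t) (auto simp: fun_eq_iff value_at_snoc opened_at_snoc deref_snoc)
qed

section \<open>A sufficient condition for determinism\<close>

text \<open>
  Determinism also allows words to part at a bracket.  Excluding this, and words that are proper
  prefixes of others unless \<open>e\<close> holds, makes the condition compositional.
\<close>

fun branching ::
    "bool \<Rightarrow> (('a, 'x) rsym \<times> nat) list \<Rightarrow> (('a, 'x) rsym \<times> nat) list \<Rightarrow> bool" where
  "branching e [] [] = True"
| "branching e (s # u) [] = (e \<and> (\<exists>c. fst s = Tm c))"
| "branching e [] (t # v) = (e \<and> (\<exists>c. fst t = Tm c))"
| "branching e (s # u) (t # v) =
     (s = t \<and> branching e u v \<or> (\<exists>c d. fst s = Tm c \<and> fst t = Tm d \<and> c \<noteq> d))"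

text \<open>Once two words have parted at different terminals, their continuations are irrelevant.
  Otherwise the first parts coincide, as \<open>False\<close> rules out proper prefixes, and only
  then are the tails compared.\<close>

lemma branching_append:
  "branching False u v \<Longrightarrow> (u = v \<Longrightarrow> branching e u' v') \<Longrightarrow> branching e (u @ u') (v @ v')"
  by (induction False u v rule: branching.induct) auto

lemma branching_mono: "branching False u v \<Longrightarrow> branching e u v"
  by (induction False u v rule: branching.induct) auto

lemma branching_same_prefix: "branching e (r @ u) (r @ v) \<Longrightarrow> branching e u v"
  by (induction r) auto

text \<open>A bracket can only face the same bracket: words part at terminals, and one may stop
  early only where the other goes on with a terminal. The last two assumptions make
  \<open>\<gamma>\<close> and \<open>\<delta>\<close> maximal bracket runs.\<close>

lemma branching_brackets:
  assumes "branching e (\<gamma> @ u) (\<delta> @ v)" "marked_brackets \<gamma>" "marked_brackets \<delta>"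
    and u: "u \<noteq> [] \<Longrightarrow> \<not> is_bracket (fst (hd u))"
    and v: "v \<noteq> [] \<Longrightarrow> \<not> is_bracket (fst (hd v))"
  shows "\<gamma> = \<delta> \<and> branching e u v"
  using assms(1-3)
proof (induction \<gamma> arbitrary: \<delta>)
  case Nil
  show ?case
  proof (cases \<delta>)
    case (Cons t \<delta>')
    with Nil u show ?thesis
      by (cases u) (auto simp: marked_brackets_def)
  qed (use Nil in simp)
next
  case (Cons s \<gamma>)
  show ?case
  proof (cases \<delta>)
    case Nil
    with Cons.prems v show ?thesis
      by (cases v) (auto simp: marked_brackets_def)
  next
    case (Cons t \<delta>')
    then have "s = t" "branching e (\<gamma> @ u) (\<delta>' @ v)"
      using Cons.prems by (auto simp: marked_brackets_def)
    with Cons Cons.prems Cons.IH[of \<delta>'] show ?thesis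
      by (simp add: marked_brackets_def)
  qed
qed

text \<open>The first number is arbitrary because a right operand is marked from wherever the left
  one stopped; \<open>marked_reflang\<close> is the case \<open>n = 0\<close>.\<close>

definition marked_lang :: "nat \<Rightarrow> ('a, 'x) regex \<Rightarrow> (('a, 'x) rsym \<times> nat) list set" where
  "marked_lang n \<alpha> = rexp_lang (fst (mark_from n (to_rexp \<alpha>)))"

definition branching_regex :: "bool \<Rightarrow> ('a, 'x) regex \<Rightarrow> bool" where
  "branching_regex e \<alpha> \<longleftrightarrow> (\<forall>n. \<forall>u\<in>marked_lang n \<alpha>. \<forall>v\<in>marked_lang n \<alpha>. branching e u v)"

definition starts_with :: "'a set \<Rightarrow> ('a, 'x) regex \<Rightarrow> bool" where
  "starts_with A \<alpha> \<longleftrightarrow> (\<forall>n. \<forall>u\<in>marked_lang n \<alpha>. \<exists>c\<in>A. \<exists>i v. u = (Tm c, i) # v)"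

text \<open>Behind a common prefix the bracket runs agree, and then follow equal marked symbols or
  two distinct terminals. The four clauses of \<open>nondeterministic\<close> would need one
  terminal under two marks, a variable against another symbol, or different bracket runs.\<close>

lemma deterministic_regexI:
  assumes "is_nonempty_regex \<alpha>" "branching_regex True \<alpha>"
  shows "deterministic_regex \<alpha>"
proof -
  have *: "\<gamma>\<^sub>1 = \<gamma>\<^sub>2 \<and> branching True u v"
    if "r @ \<gamma>\<^sub>1 @ u \<in> marked_reflang \<alpha>" "r @ \<gamma>\<^sub>2 @ v \<in> marked_reflang \<alpha>"
      "marked_brackets \<gamma>\<^sub>1" "marked_brackets \<gamma>\<^sub>2"
      "u \<noteq> [] \<Longrightarrow> \<not> is_bracket (fst (hd u))"
      "v \<noteq> [] \<Longrightarrow> \<not> is_bracket (fst (hd v))" for r \<gamma>\<^sub>1 \<gamma>\<^sub>2 u v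
  proof (rule branching_brackets[OF _ that(3-6)])
    have "branching True (r @ \<gamma>\<^sub>1 @ u) (r @ \<gamma>\<^sub>2 @ v)"
      using that(1,2) assms(2)
      by (simp add: branching_regex_def marked_lang_def marked_reflang_def)
    then show "branching True (\<gamma>\<^sub>1 @ u) (\<gamma>\<^sub>2 @ v)"
      by (rule branching_same_prefix)
  qed
  have "\<not> nondeterministic \<alpha>"
  proof
    assume "nondeterministic \<alpha>"
    then obtain \<rho>\<^sub>1 \<rho>\<^sub>2 r s\<^sub>1 s\<^sub>2 \<gamma>\<^sub>1 \<gamma>\<^sub>2 where
      \<rho>: "\<rho>\<^sub>1 \<in> marked_reflang \<alpha>" "\<rho>\<^sub>2 \<in> marked_reflang \<alpha>" and
      \<gamma>: "marked_brackets \<gamma>\<^sub>1" "marked_brackets \<gamma>\<^sub>2" and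
      "(\<exists>a i j. \<rho>\<^sub>1 = r @ \<gamma>\<^sub>1 @ [(Tm a, i)] @ s\<^sub>1 \<and> \<rho>\<^sub>2 = r @ \<gamma>\<^sub>2 @ [(Tm a, j)] @ s\<^sub>2 \<and> i \<noteq> j) \<or>
       (\<exists>x \<chi> i j. \<not> is_bracket \<chi> \<and>
          \<rho>\<^sub>1 = r @ \<gamma>\<^sub>1 @ [(Var x, i)] @ s\<^sub>1 \<and> \<rho>\<^sub>2 = r @ \<gamma>\<^sub>2 @ [(\<chi>, j)] @ s\<^sub>2 \<and> i \<noteq> j) \<or>
       (\<exists>\<chi> i. \<not> is_bracket \<chi> \<and>
          \<rho>\<^sub>1 = r @ \<gamma>\<^sub>1 @ [(\<chi>, i)] @ s\<^sub>1 \<and> \<rho>\<^sub>2 = r @ \<gamma>\<^sub>2 @ [(\<chi>, i)] @ s\<^sub>2 \<and> \<gamma>\<^sub>1 \<noteq> \<gamma>\<^sub>2) \<or>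
       \<rho>\<^sub>1 = r @ \<gamma>\<^sub>1 \<and> \<rho>\<^sub>2 = r @ \<gamma>\<^sub>2 \<and> \<gamma>\<^sub>1 \<noteq> \<gamma>\<^sub>2"
      unfolding nondeterministic_def by (elim bexE exE conjE) (rule that)
    then show False
    proof (elim disjE exE conjE, goal_cases)
      case (1 a i j)
      have "branching True ([(Tm a, i)] @ s\<^sub>1) ([(Tm a, j)] @ s\<^sub>2)"
        by (rule *[OF \<rho>[unfolded 1] \<gamma>, THEN conjunct2]) simp_all
      with 1 show ?case by simp
    next
      case (2 x \<chi> i j)
      have "branching True ([(Var x, i)] @ s\<^sub>1) ([(\<chi>, j)] @ s\<^sub>2)"
        by (rule *[OF \<rho>[unfolded 2] \<gamma>, THEN conjunct2]) (use 2 in simp_all)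
      with 2 show ?case by simp
    next
      case (3 \<chi> i)
      have "\<gamma>\<^sub>1 = \<gamma>\<^sub>2"
        by (rule *[OF \<rho>[unfolded 3] \<gamma>, THEN conjunct1]) (use 3 in simp_all)
      with 3 show ?case by simp
    next
      case 4
      have "r @ \<gamma>\<^sub>1 @ [] \<in> marked_reflang \<alpha>" "r @ \<gamma>\<^sub>2 @ [] \<in> marked_reflang \<alpha>"
        using \<rho> 4 by simp_all
      then have "\<gamma>\<^sub>1 = \<gamma>\<^sub>2"
        by (rule *[OF _ _ \<gamma>, THEN conjunct1]) simp_all
      with 4 show ?case by simp
    qed
  qed
  with assms(1) show ?thesis
    by (simp add: deterministic_regex_def is_regex_def)
qed

lemma branching_regex_mono: "branching_regex False \<alpha> \<Longrightarrow> branching_regex e \<alpha>"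
  by (auto simp: branching_regex_def intro: branching_mono)

abbreviation Star :: "('a, 'x) regex \<Rightarrow> ('a, 'x) regex" where
  "Star \<alpha> \<equiv> Alt Eps (Plus \<alpha>)"

lemma branching_regex_simps [simp]:
  "branching_regex e (Sym c)" "branching_regex e (Ref x)"
  by (auto simp: branching_regex_def marked_lang_def)

lemma starts_with_simps [simp]: "starts_with {c} (Sym c)" "starts_with {c} (Cat (Sym c) \<alpha>)"
  by (auto simp: starts_with_def marked_lang_def conc_def split_beta)

lemma branching_regex_Cat:
  "branching_regex False \<alpha> \<Longrightarrow> branching_regex e \<beta> \<Longrightarrow> branching_regex e (Cat \<alpha> \<beta>)"
  by (auto simp: branching_regex_def marked_lang_def conc_def split_beta
      intro!: branching_append)

lemma branching_regex_Bind: "branching_regex False \<alpha> \<Longrightarrow> branching_regex e (Bind x \<alpha>)"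
  by (auto simp: branching_regex_def marked_lang_def conc_def split_beta
      intro!: branching_append)

lemma starts_with_Alt:
  "starts_with A \<alpha> \<Longrightarrow> starts_with B \<beta> \<Longrightarrow> starts_with (A \<union> B) (Alt \<alpha> \<beta>)"
  by (fastforce simp: starts_with_def marked_lang_def split_beta)

lemma branching_regex_Alt:
  assumes "branching_regex e \<alpha>" "branching_regex e \<beta>"
    and "starts_with A \<alpha>" "starts_with B \<beta>" "A \<inter> B = {}"
  shows "branching_regex e (Alt \<alpha> \<beta>)"
  unfolding branching_regex_def
proof (intro allI ballI)
  fix n u v
  assume "u \<in> marked_lang n (Alt \<alpha> \<beta>)" "v \<in> marked_lang n (Alt \<alpha> \<beta>)"
  then obtain m where "u \<in> marked_lang n \<alpha> \<union> marked_lang m \<beta>" "v \<in> marked_lang n \<alpha> \<union> marked_lang m \<beta>"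
    by (auto simp: marked_lang_def split_beta)
  moreover have "branching e u v"
    if "u \<in> marked_lang k \<alpha>'" "v \<in> marked_lang l \<beta>'"
      "starts_with A' \<alpha>'" "starts_with B' \<beta>'" "A' \<inter> B' = {}"
    for k l \<alpha>' \<beta>' A' B'
  proof -
    from that obtain c d i u' j v' where "u = (Tm c, i) # u'" "v = (Tm d, j) # v'" "c \<in> A'" "d \<in> B'"
      unfolding starts_with_def by blast
    with \<open>A' \<inter> B' = {}\<close> show ?thesis by auto
  qed
  ultimately show "branching e u v"
    using assms unfolding branching_regex_def by (metis UnE Int_commute)
qed

text \<open>The next letter decides: one in \<open>A\<close> starts another factor, one outside
  \<open>A\<close> starts the rest. An empty rest is tolerated only if \<open>e\<close> holds, so
  that one induction serves both a final \<open>Plus\<close> and a star with a continuation.\<close>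

lemma branching_concat:
  assumes "\<And>u v. u \<in> L \<Longrightarrow> v \<in> L \<Longrightarrow> branching False u v"
    and start: "\<And>u. u \<in> L \<Longrightarrow> \<exists>c\<in>A. \<exists>i v. u = (Tm c, i) # v"
    and xy: "branching e x y"
    and x: "x = [] \<and> e \<or> (\<exists>d i x'. x = (Tm d, i) # x' \<and> d \<notin> A)"
    and y: "y = [] \<and> e \<or> (\<exists>d i y'. y = (Tm d, i) # y' \<and> d \<notin> A)"
    and "set us \<subseteq> L" "set vs \<subseteq> L"
  shows "branching e (concat us @ x) (concat vs @ y)"
  using assms(6,7)
proof (induction us arbitrary: vs)
  case Nil
  show ?case
  proof (cases vs)
    case Nil
    with xy show ?thesis by simp
  next
    case (Cons v vs')
    with Nil.prems start[of v] obtain c i v' where "v = (Tm c, i) # v'" "c \<in> A" by auto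
    with Cons x show ?thesis by auto
  qed
next
  case (Cons u us)
  from Cons.prems start[of u] obtain c i u' where u: "u = (Tm c, i) # u'" "c \<in> A" by auto
  show ?case
  proof (cases vs)
    case Nil
    with u y show ?thesis by auto
  next
    case (Cons v vs')
    have "branching e (u @ concat us @ x) (v @ concat vs' @ y)"
      by (rule branching_append) (use assms(1) Cons Cons.prems Cons.IH in auto)
    with Cons show ?thesis by simp
  qed
qed

lemma branching_regex_Plus:
  assumes "branching_regex False \<alpha>" "starts_with A \<alpha>"
  shows "branching_regex True (Plus \<alpha>)"
  unfolding branching_regex_def
proof (intro allI ballI)
  fix n u v
  assume "u \<in> marked_lang n (Plus \<alpha>)" "v \<in> marked_lang n (Plus \<alpha>)"
  then obtain us vs where "u = concat us" "v = concat vs"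
      "set us \<subseteq> marked_lang n \<alpha>" "set vs \<subseteq> marked_lang n \<alpha>"
    by (auto simp: marked_lang_def lang_plus_def split_beta)
  then show "branching True u v"
    using branching_concat[of "marked_lang n \<alpha>" A True "[]" "[]" us vs] assms
    by (auto simp: branching_regex_def starts_with_def)
qed

lemma branching_regex_Star_Cat:
  assumes "branching_regex False \<alpha>" "starts_with A \<alpha>"
    and "branching_regex e \<beta>" "starts_with B \<beta>" "A \<inter> B = {}"
  shows "branching_regex e (Cat (Star \<alpha>) \<beta>)"
  unfolding branching_regex_def
proof (intro allI ballI)
  fix n u v
  assume uv: "u \<in> marked_lang n (Cat (Star \<alpha>) \<beta>)" "v \<in> marked_lang n (Cat (Star \<alpha>) \<beta>)"
  define m where "m = snd (mark_from n (to_rexp \<alpha>))"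
  have *: "\<exists>ws x. w = concat ws @ x \<and> set ws \<subseteq> marked_lang n \<alpha> \<and> x \<in> marked_lang m \<beta>"
    if "w \<in> marked_lang n (Cat (Star \<alpha>) \<beta>)" for w
  proof -
    from that consider "w \<in> marked_lang m \<beta>"
      | ws x where "w = concat ws @ x" "set ws \<subseteq> marked_lang n \<alpha>" "x \<in> marked_lang m \<beta>"
      by (auto simp: marked_lang_def lang_plus_def conc_def m_def split_beta)
    then show ?thesis
    proof cases
      case 1
      then have "w = concat [] @ w \<and> set [] \<subseteq> marked_lang n \<alpha> \<and> w \<in> marked_lang m \<beta>"
        by simp
      then show ?thesis by blast
    qed blast
  qed
  from *[OF uv(1)] obtain us x where
    u: "u = concat us @ x" "set us \<subseteq> marked_lang n \<alpha>" "x \<in> marked_lang m \<beta>" by blast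
  from *[OF uv(2)] obtain vs y where
    v: "v = concat vs @ y" "set vs \<subseteq> marked_lang n \<alpha>" "y \<in> marked_lang m \<beta>" by blast
  have \<beta>: "\<exists>d i x'. z = (Tm d, i) # x' \<and> d \<notin> A" if "z \<in> marked_lang m \<beta>" for z
  proof -
    from that assms(4) obtain d i x' where "d \<in> B" "z = (Tm d, i) # x'"
      unfolding starts_with_def by blast
    with assms(5) show ?thesis by blast
  qed
  show "branching e u v"
    unfolding u(1) v(1)
  proof (rule branching_concat)
    show "branching e x y"
      using assms(3) u(3) v(3) by (simp add: branching_regex_def)
    show "x = [] \<and> e \<or> (\<exists>d i x'. x = (Tm d, i) # x' \<and> d \<notin> A)"
      using \<beta>[OF u(3)] by blast
    show "y = [] \<and> e \<or> (\<exists>d i x'. y = (Tm d, i) # x' \<and> d \<notin> A)"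
      using \<beta>[OF v(3)] by blast
  qed (use u v assms(1,2) in \<open>auto simp: branching_regex_def starts_with_def\<close>)
qed

section \<open>While programs and their regex\<close>

text \<open>Values that one binding can form in unary notation. There is no predecessor; it comes
  from the guess made by a loop.\<close>

datatype rhs = Null | Same nat | Next nat

datatype prog =
    Assign nat rhs
  | Seq prog prog
  | Loop nat nat prog

type_synonym store = "nat \<Rightarrow> nat"

primrec rhs_val :: "rhs \<Rightarrow> store \<Rightarrow> nat" where
  "rhs_val Null \<sigma> = 0"
| "rhs_val (Same s) \<sigma> = \<sigma> s"
| "rhs_val (Next s) \<sigma> = Suc (\<sigma> s)"

primrec rhs_regs :: "rhs \<Rightarrow> nat set" where
  "rhs_regs Null = {}"
| "rhs_regs (Same s) = {s}"
| "rhs_regs (Next s) = {s}"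

primrec regs :: "prog \<Rightarrow> nat set" where
  "regs (Assign r e) = insert r (rhs_regs e)"
| "regs (Seq p q) = regs p \<union> regs q"
| "regs (Loop r s p) = {r, s} \<union> regs p"

text \<open>The condition on assignments mirrors that on bindings, which must not enclose a
  reference to their own variable; an increment thus needs an auxiliary register. A loop may have
  \<open>r = s\<close>, since its references to \<open>r\<close> stand outside the binding of
  \<open>s\<close>.\<close>

primrec wf_prog :: "prog \<Rightarrow> bool" where
  "wf_prog (Assign r e) \<longleftrightarrow> r \<notin> rhs_regs e"
| "wf_prog (Seq p q) \<longleftrightarrow> wf_prog p \<and> wf_prog q"
| "wf_prog (Loop r s p) \<longleftrightarrow> wf_prog p"

lemma finite_regs: "finite (regs p)"
proof (induction p)
  case (Assign r e)
  then show ?case by (cases e) auto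
qed auto

text \<open>\<open>Loop r s p\<close> is ``while \<open>r \<noteq> 0\<close> do (\<open>s := r - 1\<close>; \<open>p\<close>)''.\<close>

inductive exec :: "prog \<Rightarrow> store \<Rightarrow> store \<Rightarrow> bool" where
  Assign: "exec (Assign r e) \<sigma> (\<sigma>(r := rhs_val e \<sigma>))"
| Seq: "exec p \<sigma> \<sigma>' \<Longrightarrow> exec q \<sigma>' \<sigma>'' \<Longrightarrow> exec (Seq p q) \<sigma> \<sigma>''"
| Loop_exit: "\<sigma> r = 0 \<Longrightarrow> exec (Loop r s p) \<sigma> \<sigma>"
| Loop_step: "\<sigma> r = Suc n \<Longrightarrow> exec p (\<sigma>(s := n)) \<sigma>' \<Longrightarrow> exec (Loop r s p) \<sigma>' \<sigma>'' \<Longrightarrow>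
    exec (Loop r s p) \<sigma> \<sigma>''"

lemma fold_dstep_terminals: "fold dstep (map Tm u) (\<rho>, P, w) = (\<rho>, P, w @ u)"
  by (induction u arbitrary: w) auto

lemma fold_dstep_extends: "\<exists>\<rho>' P' u. fold dstep v (\<rho>, P, w) = (\<rho>', P', w @ u)"
proof (induction v arbitrary: \<rho> P w)
  case (Cons s v)
  obtain \<rho>\<^sub>1 P\<^sub>1 u\<^sub>1 where "dstep s (\<rho>, P, w) = (\<rho>\<^sub>1, P\<^sub>1, w @ u\<^sub>1)"
    by (cases s) auto
  with Cons.IH[of \<rho>\<^sub>1 P\<^sub>1 "w @ u\<^sub>1"] show ?case
    by auto
qed auto

lemma concI: "u \<in> A \<Longrightarrow> v \<in> B \<Longrightarrow> u @ v \<in> conc A B"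
  by (auto simp: conc_def)

lemma reflang_Star_Cat:
  "reflang (Cat (Star \<alpha>) \<beta>) = {concat ws @ y | ws y. set ws \<subseteq> reflang \<alpha> \<and> y \<in> reflang \<beta>}"
proof (intro equalityI subsetI)
  fix v assume "v \<in> reflang (Cat (Star \<alpha>) \<beta>)"
  then obtain x y where v: "v = x @ y" "y \<in> reflang \<beta>" "x = [] \<or> x \<in> lang_plus (reflang \<alpha>)"
    by (auto simp: conc_def)
  then have "\<exists>ws. x = concat ws \<and> set ws \<subseteq> reflang \<alpha>"
  proof (elim disjE)
    assume "x = []"
    then show ?thesis by (intro exI[of _ "[]"]) simp
  qed (auto simp: lang_plus_def)
  with v show "v \<in> {concat ws @ y | ws y. set ws \<subseteq> reflang \<alpha> \<and> y \<in> reflang \<beta>}"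
    by blast
next
  fix v assume "v \<in> {concat ws @ y | ws y. set ws \<subseteq> reflang \<alpha> \<and> y \<in> reflang \<beta>}"
  then obtain ws y where v: "v = concat ws @ y" "set ws \<subseteq> reflang \<alpha>" "y \<in> reflang \<beta>"
    by blast
  then have "concat ws \<in> reflang (Star \<alpha>)"
    by (cases "ws = []") (auto simp: lang_plus_def)
  with v show "v \<in> reflang (Cat (Star \<alpha>) \<beta>)"
    unfolding reflang.simps(5) conc_def by blast
qed

section \<open>Numbers as words, records and traces\<close>

context
  fixes a b :: 'a
  assumes ab: "a \<noteq> b"
begin

primrec num :: "nat \<Rightarrow> 'a list" where
  "num 0 = [b]"
| "num (Suc n) = a # num n"

text \<open>The closing \<open>b\<close> keeps any number from being a proper prefix of another, so
  equations between traces are solved number by number.\<close>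

lemma num_append_eq: "num m @ u = num n @ v \<longleftrightarrow> m = n \<and> u = v"
proof (induction m arbitrary: n)
  case 0
  then show ?case using ab by (cases n) auto
next
  case (Suc m)
  then show ?case using ab by (cases n) auto
qed

definition any_num :: "('a, nat) regex" where
  "any_num = Cat (Star (Sym a)) (Sym b)"

primrec rhs_regex :: "rhs \<Rightarrow> ('a, nat) regex" where
  "rhs_regex Null = Sym b"
| "rhs_regex (Same s) = Ref s"
| "rhs_regex (Next s) = Cat (Sym a) (Ref s)"

text \<open>
  The content \<open>n\<close> of a register is the value \<open>a\<^sup>n b\<close> of a variable.  An assignment writes
  the new value twice, and a decrement writes the old value and then \<open>a\<close> followed by a guessed
  new value, so that both traces have the form \<open>a u u\<close> exactly if the guess is right; the test for
  zero writes \<open>b\<close> and then the value, which has to be \<open>b\<close>.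
\<close>

primrec prog_regex :: "prog \<Rightarrow> ('a, nat) regex" where
  "prog_regex (Assign r e) = Cat (Sym a) (Cat (Bind r (rhs_regex e)) (Ref r))"
| "prog_regex (Seq p q) = Cat (prog_regex p) (prog_regex q)"
| "prog_regex (Loop r s p) =
     Cat (Star (Cat (Sym a) (Cat (Ref r) (Cat (Sym a) (Cat (Bind s any_num) (prog_regex p))))))
         (Cat (Sym b) (Ref r))"

text \<open>Variable \<open>0\<close> is unrelated to register \<open>0\<close>: the two regex are
  evaluated separately, and each record binds the variable afresh before referring to it.\<close>

definition trace_record :: "('a, nat) regex" where
  "trace_record = Alt (Cat (Sym a) (Cat (Bind 0 any_num) (Ref 0))) (Cat (Sym b) (Sym b))"

text \<open>Records are split off at the front because a run is verified from left to right.
  \<open>Exit\<close> is a passed zero test: \<open>b\<close> followed by \<open>num 0\<close>,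
  which is another \<open>b\<close>.\<close>

inductive_set traces :: "'a list set" where
  Nil: "[] \<in> traces"
| Step: "w \<in> traces \<Longrightarrow> a # num n @ num n @ w \<in> traces"
| Exit: "w \<in> traces \<Longrightarrow> b # b # w \<in> traces"

lemma traces_StepD: "a # v \<in> traces \<Longrightarrow> \<exists>n w. v = num n @ num n @ w \<and> w \<in> traces"
  by (erule traces.cases) (use ab in auto)

lemma traces_ExitD: "b # v \<in> traces \<Longrightarrow> \<exists>w. v = b # w \<and> w \<in> traces"
  by (erule traces.cases) (use ab in auto)

lemma traces_Exit_iff: "b # num n @ z \<in> traces \<longleftrightarrow> n = 0 \<and> z \<in> traces"
proof
  assume "b # num n @ z \<in> traces"
  from traces_ExitD[OF this] obtain w where "num n @ z = num 0 @ w" "w \<in> traces"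
    by auto
  then show "n = 0 \<and> z \<in> traces"
    by (simp only: num_append_eq)
qed (auto intro: traces.Exit)

text \<open>The letter \<open>a\<close> selects a comparing record, and unique parsing identifies
  both numbers with the one repeated there. Here wrong guesses are rejected.\<close>

lemma traces_Step_iff: "a # num m @ num n @ z \<in> traces \<longleftrightarrow> m = n \<and> z \<in> traces"
proof
  assume "a # num m @ num n @ z \<in> traces"
  from traces_StepD[OF this] obtain k w where "num m @ num n @ z = num k @ num k @ w" "w \<in> traces"
    by blast
  then show "m = n \<and> z \<in> traces"
    by (simp only: num_append_eq)
next
  assume "m = n \<and> z \<in> traces"
  then show "a # num m @ num n @ z \<in> traces"
    using traces.Step by simp
qed

lemma reflang_any_num: "reflang any_num = {map Tm (num n) | n. True}"
proof (intro equalityI subsetI)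
  fix v assume "v \<in> reflang any_num"
  then obtain ws where ws: "v = concat ws @ [Tm b]" "set ws \<subseteq> {[Tm a]}"
    unfolding any_num_def reflang_Star_Cat by auto
  from ws(2) have "concat ws @ [Tm b] = map Tm (num (length ws))"
    by (induction ws) auto
  with ws(1) show "v \<in> {map Tm (num n) | n. True}"
    by blast
next
  fix v :: "('a, nat) rsym list" assume "v \<in> {map Tm (num n) | n. True}"
  then obtain n where "v = map Tm (num n)" by blast
  also have "\<dots> = concat (replicate n [Tm a]) @ [Tm b]"
    by (induction n) auto
  finally have "v = concat (replicate n [Tm a]) @ [Tm b] \<and> set (replicate n [Tm a]) \<subseteq> {[Tm a]}"
    by auto
  then show "v \<in> reflang any_num"
    unfolding any_num_def reflang_Star_Cat mem_Collect_eq
    by (intro exI[of _ "replicate n [Tm a]"] exI[of _ "[Tm b]"]) simp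
qed

text \<open>Restricted to \<open>V\<close> because a variable that was never bound has the empty
  word as its value, which is not even the code of zero.\<close>

definition represents :: "nat set \<Rightarrow> (nat \<Rightarrow> 'a list) \<Rightarrow> store \<Rightarrow> bool" where
  "represents V \<rho> \<sigma> \<longleftrightarrow> (\<forall>r\<in>V. \<rho> r = num (\<sigma> r))"

lemma represents_upd: "represents V \<rho> \<sigma> \<Longrightarrow> represents V (\<rho>(r := num n)) (\<sigma>(r := n))"
  by (auto simp: represents_def)

lemma reflang_rhs_regex:
  assumes "represents V \<rho> \<sigma>" "rhs_regs e \<subseteq> V"
  obtains v where "reflang (rhs_regex e) = {v}"
    "\<And>P w. fold dstep v (\<rho>, P, w) = (\<rho>, P, w @ num (rhs_val e \<sigma>))"
proof (cases e)
  case Null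
  then show ?thesis by (intro that[of "[Tm b]"]) auto
next
  case (Same s)
  with assms show ?thesis by (intro that[of "[Var s]"]) (auto simp: represents_def)
next
  case (Next s)
  with assms show ?thesis
    by (intro that[of "[Tm a, Var s]"]) (auto simp: represents_def conc_def)
qed

lemma fold_dstep_Bind:
  assumes "fold dstep v (\<rho>, P(r := Some (length w)), w) = (\<rho>, P(r := Some (length w)), w @ u)"
  shows "fold dstep (Opn r # v @ Cls r # v') (\<rho>, P, w) =
    fold dstep v' (\<rho>(r := u), P(r := Some (length w)), w @ u)"
  using assms by simp

lemma fold_dstep_Assign:
  assumes "\<And>P w. fold dstep v (\<rho>, P, w) = (\<rho>, P, w @ u)"
  shows "fold dstep (Tm a # Opn r # v @ [Cls r, Var r]) (\<rho>, P, w) =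
    (\<rho>(r := u), P(r := Some (Suc (length w))), w @ a # u @ u)"
  using fold_dstep_Bind[OF assms, of r "[Var r]" P "w @ [a]"] by simp

text \<open>\<open>Var r\<close> is read before \<open>Cls s\<close> takes effect, so
  \<open>r = s\<close> is covered. The second \<open>a\<close> stands before the bracket: it belongs
  to the number being checked but not to the one being stored.\<close>

lemma fold_dstep_decrement:
  "fold dstep (Tm a # Var r # Tm a # Opn s # map Tm u @ Cls s # v) (\<rho>, P, w) =
    fold dstep v (\<rho>(s := u), P(s := Some (length (w @ a # \<rho> r @ [a]))), w @ a # \<rho> r @ a # u)"
  by (simp add: fold_dstep_terminals)

definition loop_body :: "nat \<Rightarrow> nat \<Rightarrow> prog \<Rightarrow> ('a, nat) rsym list set" where
  "loop_body r s p =
     {Tm a # Var r # Tm a # Opn s # map Tm (num n) @ Cls s # v | n v. v \<in> reflang (prog_regex p)}"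

lemma reflang_Loop:
  "reflang (prog_regex (Loop r s p)) =
     {concat vs @ [Tm b, Var r] | vs. set vs \<subseteq> loop_body r s p}"
proof -
  have "reflang (Cat (Sym a) (Cat (Ref r) (Cat (Sym a) (Cat (Bind s any_num) (prog_regex p))))) =
      loop_body r s p" (is "reflang ?\<alpha> = _")
  proof (intro equalityI subsetI)
    fix x assume "x \<in> reflang ?\<alpha>"
    then obtain n v where "x = Tm a # Var r # Tm a # Opn s # map Tm (num n) @ Cls s # v"
        "v \<in> reflang (prog_regex p)"
      unfolding reflang.simps conc_def reflang_any_num by auto
    then show "x \<in> loop_body r s p"
      unfolding loop_body_def by blast
  next
    fix x assume "x \<in> loop_body r s p"
    then obtain n v where
      x: "x = [Tm a] @ [Var r] @ [Tm a] @ ([Opn s] @ map Tm (num n) @ [Cls s]) @ v"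
      and v: "v \<in> reflang (prog_regex p)"
      unfolding loop_body_def by auto
    have "map Tm (num n) \<in> reflang any_num"
      unfolding reflang_any_num by blast
    with v show "x \<in> reflang ?\<alpha>"
      unfolding x reflang.simps by (intro concI) simp_all
  qed
  then show ?thesis
    unfolding prog_regex.simps reflang_Star_Cat by (auto simp: conc_def)
qed

text \<open>The checker only vouches for the whole trace, not for the piece written by
  \<open>p\<close>. The arbitrary rest \<open>z\<close> lets sequences and loops consume the trace
  piece by piece. The earlier output \<open>w\<close> is arbitrary because recorded positions refer
  to the full output.\<close>

lemma prog_regex_sound:
  assumes "v \<in> reflang (prog_regex p)" "regs p \<subseteq> V" "represents V \<rho> \<sigma>"
    and "fold dstep v (\<rho>, P, w) = (\<rho>', P', w @ u)" "u @ z \<in> traces"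
  shows "z \<in> traces \<and> (\<exists>\<sigma>'. exec p \<sigma> \<sigma>' \<and> represents V \<rho>' \<sigma>')"
  using assms
proof (induction p arbitrary: v \<rho> \<sigma> P w \<rho>' P' u z)
  case (Assign r e)
  obtain v' where v': "reflang (rhs_regex e) = {v'}"
      "\<And>P w. fold dstep v' (\<rho>, P, w) = (\<rho>, P, w @ num (rhs_val e \<sigma>))"
    using reflang_rhs_regex[of V \<rho> \<sigma> e] Assign.prems by auto
  have "v = Tm a # Opn r # v' @ [Cls r, Var r]"
    using Assign.prems(1) v'(1) by (auto simp: conc_def)
  with Assign.prems(4) fold_dstep_Assign[OF v'(2)]
  have *: "\<rho>' = \<rho>(r := num (rhs_val e \<sigma>))" "u = a # num (rhs_val e \<sigma>) @ num (rhs_val e \<sigma>)"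
    by auto
  with Assign.prems(5) have "a # num (rhs_val e \<sigma>) @ num (rhs_val e \<sigma>) @ z \<in> traces"
    by simp
  then have "z \<in> traces"
    by (simp only: traces_Step_iff)
  with *(1) show ?case
    using exec.Assign represents_upd[OF Assign.prems(3)] by blast
next
  case (Seq p q)
  from Seq.prems(1) obtain v\<^sub>1 v\<^sub>2 where
    v: "v = v\<^sub>1 @ v\<^sub>2" "v\<^sub>1 \<in> reflang (prog_regex p)" "v\<^sub>2 \<in> reflang (prog_regex q)"
    by (auto simp: conc_def)
  obtain \<rho>\<^sub>1 P\<^sub>1 u\<^sub>1 where 1: "fold dstep v\<^sub>1 (\<rho>, P, w) = (\<rho>\<^sub>1, P\<^sub>1, w @ u\<^sub>1)"
    using fold_dstep_extends by blast
  obtain u\<^sub>2 where 2: "fold dstep v\<^sub>2 (\<rho>\<^sub>1, P\<^sub>1, w @ u\<^sub>1) = (\<rho>', P', (w @ u\<^sub>1) @ u\<^sub>2)" "u = u\<^sub>1 @ u\<^sub>2"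
    using fold_dstep_extends[of v\<^sub>2 \<rho>\<^sub>1 P\<^sub>1 "w @ u\<^sub>1"] 1 v(1) Seq.prems(4) by auto
  from Seq.IH(1)[OF v(2) _ Seq.prems(3) 1, of "u\<^sub>2 @ z"] Seq.prems 2(2) obtain \<sigma>\<^sub>1 where
    "u\<^sub>2 @ z \<in> traces" "exec p \<sigma> \<sigma>\<^sub>1" "represents V \<rho>\<^sub>1 \<sigma>\<^sub>1"
    by auto
  moreover from this have "z \<in> traces \<and> (\<exists>\<sigma>'. exec q \<sigma>\<^sub>1 \<sigma>' \<and> represents V \<rho>' \<sigma>')"
    by (intro Seq.IH(2)[OF v(3) _ _ 2(1)]) (use Seq.prems(2) in auto)
  ultimately show ?case
    by (blast intro: exec.Seq)
next
  case (Loop r s p)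
  from Loop.prems(1) obtain vs where
    v: "v = concat vs @ [Tm b, Var r]" "set vs \<subseteq> loop_body r s p"
    unfolding reflang_Loop by blast
  \<comment> \<open>The star is unrolled by an inner induction over its iterations; the outer
    hypothesis handles the body within each of them.\<close>
  from v(2) Loop.prems(3,5) Loop.prems(4)[unfolded v(1)] show ?case
  proof (induction vs arbitrary: \<rho> \<sigma> P w u)
    case Nil
    have "\<rho> r = num (\<sigma> r)"
      using Nil.prems(2) Loop.prems(2) by (auto simp: represents_def)
    with Nil.prems(3,4) have "b # num (\<sigma> r) @ z \<in> traces" "\<rho>' = \<rho>"
      by auto
    then show ?case
      using Nil.prems(2) by (auto simp only: traces_Exit_iff intro: exec.Loop_exit)
  next
    case (Cons v\<^sub>0 vs)
    from Cons.prems(1) obtain n v\<^sub>1 where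
      v0: "v\<^sub>0 = Tm a # Var r # Tm a # Opn s # map Tm (num n) @ Cls s # v\<^sub>1"
        "v\<^sub>1 \<in> reflang (prog_regex p)"
      by (auto simp: loop_body_def)
    have r: "\<rho> r = num (\<sigma> r)"
      using Cons.prems(2) Loop.prems(2) by (auto simp: represents_def)
    let ?\<rho> = "\<rho>(s := num n)" and ?w = "w @ a # \<rho> r @ a # num n"
    let ?P = "P(s := Some (length (w @ a # \<rho> r @ [a])))"
    obtain \<rho>\<^sub>1 P\<^sub>1 u\<^sub>1 where 1: "fold dstep v\<^sub>1 (?\<rho>, ?P, ?w) = (\<rho>\<^sub>1, P\<^sub>1, ?w @ u\<^sub>1)"
      using fold_dstep_extends by blast
    have 0: "fold dstep v\<^sub>0 (\<rho>, P, w) = (\<rho>\<^sub>1, P\<^sub>1, ?w @ u\<^sub>1)"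
      unfolding v0 fold_dstep_decrement 1 ..
    obtain \<rho>\<^sub>2 P\<^sub>2 u\<^sub>2 where
      2: "fold dstep (concat vs @ [Tm b, Var r]) (\<rho>\<^sub>1, P\<^sub>1, ?w @ u\<^sub>1) = (\<rho>\<^sub>2, P\<^sub>2, (?w @ u\<^sub>1) @ u\<^sub>2)"
      using fold_dstep_extends by blast
    have "fold dstep (concat (v\<^sub>0 # vs) @ [Tm b, Var r]) (\<rho>, P, w) = (\<rho>\<^sub>2, P\<^sub>2, (?w @ u\<^sub>1) @ u\<^sub>2)"
      using 0 2 by simp
    with Cons.prems(4) have
      eq: "\<rho>\<^sub>2 = \<rho>'" "P\<^sub>2 = P'" "u = a # \<rho> r @ a # num n @ u\<^sub>1 @ u\<^sub>2"
      by auto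
    \<comment> \<open>The \<open>a\<close> before the guess turns \<open>num n\<close> into
      \<open>num (Suc n)\<close>. The record thus shows both that the loop test succeeds and that
      the guess is the predecessor.\<close>
    with Cons.prems(3) r have "a # num (\<sigma> r) @ num (Suc n) @ u\<^sub>1 @ u\<^sub>2 @ z \<in> traces"
      by simp
    then have t: "\<sigma> r = Suc n" "u\<^sub>1 @ u\<^sub>2 @ z \<in> traces"
      by (simp_all only: traces_Step_iff)
    obtain \<sigma>\<^sub>1 where "u\<^sub>2 @ z \<in> traces" "exec p (\<sigma>(s := n)) \<sigma>\<^sub>1" "represents V \<rho>\<^sub>1 \<sigma>\<^sub>1"
      using Loop.IH[OF v0(2) _ represents_upd[OF Cons.prems(2)] 1 t(2)] Loop.prems(2)
      unfolding regs.simps le_sup_iff by blast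
    moreover have "z \<in> traces \<and> (\<exists>\<sigma>'. exec (Loop r s p) \<sigma>\<^sub>1 \<sigma>' \<and> represents V \<rho>' \<sigma>')"
      by (rule Cons.IH[OF _ \<open>represents V \<rho>\<^sub>1 \<sigma>\<^sub>1\<close> \<open>u\<^sub>2 @ z \<in> traces\<close> 2[unfolded eq]])
        (use Cons.prems(1) in auto)
    ultimately show ?case
      using exec.Loop_step[of \<sigma> r n, OF t(1)] by blast
  qed
qed

text \<open>The induction follows the run, and at each decrement guesses the number that the run
  stores.\<close>

lemma prog_regex_complete:
  assumes "exec p \<sigma> \<sigma>'" "regs p \<subseteq> V" "represents V \<rho> \<sigma>"
  shows "\<exists>v\<in>reflang (prog_regex p). \<exists>\<rho>' P' u.
    fold dstep v (\<rho>, P, w) = (\<rho>', P', w @ u) \<and> represents V \<rho>' \<sigma>' \<and>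
    (\<forall>z\<in>traces. u @ z \<in> traces)"
  using assms
proof (induction arbitrary: \<rho> P w rule: exec.induct)
  case (Assign r e \<sigma>)
  obtain v where v: "reflang (rhs_regex e) = {v}"
      "\<And>P w. fold dstep v (\<rho>, P, w) = (\<rho>, P, w @ num (rhs_val e \<sigma>))"
    using reflang_rhs_regex[of V \<rho> \<sigma> e] Assign.prems by auto
  have "Tm a # Opn r # v @ [Cls r, Var r] \<in> reflang (prog_regex (Assign r e))"
    using v(1) by (auto simp: conc_def)
  moreover have "\<forall>z\<in>traces. (a # num (rhs_val e \<sigma>) @ num (rhs_val e \<sigma>)) @ z \<in> traces"
    using traces.Step[of _ "rhs_val e \<sigma>"] by simp
  ultimately show ?case
    using fold_dstep_Assign[OF v(2)] represents_upd[OF Assign.prems(2)] by blast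
next
  case (Seq p \<sigma> \<sigma>' q \<sigma>'')
  from Seq.IH(1)[OF _ Seq.prems(2), of P w] Seq.prems(1) obtain v\<^sub>1 \<rho>\<^sub>1 P\<^sub>1 u\<^sub>1 where
    1: "v\<^sub>1 \<in> reflang (prog_regex p)" "fold dstep v\<^sub>1 (\<rho>, P, w) = (\<rho>\<^sub>1, P\<^sub>1, w @ u\<^sub>1)"
      "represents V \<rho>\<^sub>1 \<sigma>'" "\<forall>z\<in>traces. u\<^sub>1 @ z \<in> traces"
    by auto
  from Seq.IH(2)[OF _ 1(3), of P\<^sub>1 "w @ u\<^sub>1"] Seq.prems(1) obtain v\<^sub>2 \<rho>\<^sub>2 P\<^sub>2 u\<^sub>2 where
    2: "v\<^sub>2 \<in> reflang (prog_regex q)" "fold dstep v\<^sub>2 (\<rho>\<^sub>1, P\<^sub>1, w @ u\<^sub>1) = (\<rho>\<^sub>2, P\<^sub>2, (w @ u\<^sub>1) @ u\<^sub>2)"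
      "represents V \<rho>\<^sub>2 \<sigma>''" "\<forall>z\<in>traces. u\<^sub>2 @ z \<in> traces"
    by auto
  have "v\<^sub>1 @ v\<^sub>2 \<in> reflang (prog_regex (Seq p q))"
    using 1(1) 2(1) by (auto simp: conc_def)
  moreover have "fold dstep (v\<^sub>1 @ v\<^sub>2) (\<rho>, P, w) = (\<rho>\<^sub>2, P\<^sub>2, w @ u\<^sub>1 @ u\<^sub>2)"
    using 1(2) 2(2) by simp
  moreover have "\<forall>z\<in>traces. (u\<^sub>1 @ u\<^sub>2) @ z \<in> traces"
    using 1(4) 2(4) by simp
  ultimately show ?case
    using 2(3) by blast
next
  case (Loop_exit \<sigma> r s p)
  have "concat [] @ [Tm b, Var r] \<in> reflang (prog_regex (Loop r s p))"
    unfolding reflang_Loop by fastforce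
  moreover have "fold dstep (concat [] @ [Tm b, Var r]) (\<rho>, P, w) = (\<rho>, P, w @ [b, b])"
    using Loop_exit by (auto simp: represents_def)
  moreover have "\<forall>z\<in>traces. [b, b] @ z \<in> traces"
    using traces.Exit by simp
  ultimately show ?case
    using Loop_exit.prems(2) by blast
next
  case (Loop_step \<sigma> r n p s \<sigma>' \<sigma>'')
  let ?\<rho> = "\<rho>(s := num n)" and ?w = "w @ a # \<rho> r @ a # num n"
  let ?P = "P(s := Some (length (w @ a # \<rho> r @ [a])))"
  have "regs p \<subseteq> V"
    using Loop_step.prems(1) by simp
  from Loop_step.IH(1)[OF this represents_upd[OF Loop_step.prems(2)], of ?P ?w]
  obtain v\<^sub>1 \<rho>\<^sub>1 P\<^sub>1 u\<^sub>1 where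
    1: "v\<^sub>1 \<in> reflang (prog_regex p)" "fold dstep v\<^sub>1 (?\<rho>, ?P, ?w) = (\<rho>\<^sub>1, P\<^sub>1, ?w @ u\<^sub>1)"
      "represents V \<rho>\<^sub>1 \<sigma>'" "\<forall>z\<in>traces. u\<^sub>1 @ z \<in> traces"
    by blast
  from Loop_step.IH(2)[OF Loop_step.prems(1) 1(3), of P\<^sub>1 "?w @ u\<^sub>1"] obtain v\<^sub>2 \<rho>\<^sub>2 P\<^sub>2 u\<^sub>2 where
    2: "v\<^sub>2 \<in> reflang (prog_regex (Loop r s p))"
      "fold dstep v\<^sub>2 (\<rho>\<^sub>1, P\<^sub>1, ?w @ u\<^sub>1) = (\<rho>\<^sub>2, P\<^sub>2, (?w @ u\<^sub>1) @ u\<^sub>2)"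
      "represents V \<rho>\<^sub>2 \<sigma>''" "\<forall>z\<in>traces. u\<^sub>2 @ z \<in> traces"
    by blast
  let ?v = "Tm a # Var r # Tm a # Opn s # map Tm (num n) @ Cls s # v\<^sub>1"
  from 2(1) obtain vs where vs: "v\<^sub>2 = concat vs @ [Tm b, Var r]" "set vs \<subseteq> loop_body r s p"
    unfolding reflang_Loop by blast
  have "?v \<in> loop_body r s p"
    using 1(1) by (auto simp: loop_body_def)
  with vs have "?v @ v\<^sub>2 = concat (?v # vs) @ [Tm b, Var r] \<and> set (?v # vs) \<subseteq> loop_body r s p"
    by simp
  then have "?v @ v\<^sub>2 \<in> reflang (prog_regex (Loop r s p))"
    unfolding reflang_Loop by blast
  moreover have "fold dstep ?v (\<rho>, P, w) = (\<rho>\<^sub>1, P\<^sub>1, ?w @ u\<^sub>1)"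
    unfolding fold_dstep_decrement 1(2) ..
  then have "fold dstep (?v @ v\<^sub>2) (\<rho>, P, w) = (\<rho>\<^sub>2, P\<^sub>2, w @ (a # \<rho> r @ a # num n @ u\<^sub>1 @ u\<^sub>2))"
    using 2(2) unfolding fold_append by simp
  moreover have "(a # \<rho> r @ a # num n @ u\<^sub>1 @ u\<^sub>2) @ z \<in> traces" if "z \<in> traces" for z
  proof -
    have "\<rho> r = num (Suc n)"
      using Loop_step.prems Loop_step.hyps(1) by (auto simp: represents_def)
    then show ?thesis
      using that 1(4) 2(4) traces.Step[of "u\<^sub>1 @ u\<^sub>2 @ z" "Suc n"] by simp
  qed
  ultimately show ?case
    using 2(3) by blast
qed

section \<open>The language of the checking regex\<close>

definition check_regex :: "('a, nat) regex" where
  "check_regex = Plus trace_record"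

lemma reflang_trace_record:
  "reflang trace_record =
     {Tm a # Opn 0 # map Tm (num n) @ [Cls 0, Var 0] | n. True} \<union> {[Tm b, Tm b]}"
  (is "_ = ?A \<union> ?B")
proof -
  have "reflang (Cat (Sym a) (Cat (Bind 0 any_num) (Ref 0))) = ?A"
  proof (intro equalityI subsetI)
    fix x assume "x \<in> reflang (Cat (Sym a) (Cat (Bind 0 any_num) (Ref 0)))"
    then show "x \<in> ?A"
      unfolding reflang.simps conc_def reflang_any_num by auto
  next
    fix x assume "x \<in> ?A"
    then obtain n where x: "x = [Tm a] @ ([Opn 0] @ map Tm (num n) @ [Cls 0]) @ [Var 0]"
      by auto
    have "map Tm (num n) \<in> reflang any_num"
      unfolding reflang_any_num by blast
    then show "x \<in> reflang (Cat (Sym a) (Cat (Bind 0 any_num) (Ref 0)))"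
      unfolding x reflang.simps by (intro concI) simp_all
  qed
  moreover have "reflang (Cat (Sym b) (Sym b)) = ?B"
    by (auto simp: conc_def)
  ultimately show ?thesis
    by (simp add: trace_record_def del: reflang.simps(3-5,8))
qed

lemma fold_dstep_trace_Step:
  "fold dstep (Tm a # Opn 0 # map Tm (num n) @ [Cls 0, Var 0]) (\<rho>, P, w) =
     (\<rho>(0 := num n), P(0 := Some (Suc (length w))), w @ a # num n @ num n)"
  by (rule fold_dstep_Assign[OF fold_dstep_terminals])

lemma trace_records_sound:
  assumes "set ws \<subseteq> reflang trace_record"
  shows "\<exists>\<rho>' P'. \<exists>u\<in>traces. fold dstep (concat ws) (\<rho>, P, w) = (\<rho>', P', w @ u)"
  using assms
proof (induction ws arbitrary: \<rho> P w)
  case Nil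
  then show ?case
    using traces.Nil by auto
next
  case (Cons v ws)
  have IH: "\<exists>\<rho>' P'. \<exists>u\<in>traces. fold dstep (concat ws) (\<rho>, P, w) = (\<rho>', P', w @ u)" for \<rho> P w
    by (rule Cons.IH) (use Cons.prems in simp)
  from Cons.prems consider n where "v = Tm a # Opn 0 # map Tm (num n) @ [Cls 0, Var 0]"
    | "v = [Tm b, Tm b]"
    unfolding reflang_trace_record by auto
  then show ?case
  proof cases
    case (1 n)
    obtain \<rho>' P' u where "u \<in> traces"
      "fold dstep (concat ws) (\<rho>(0 := num n), P(0 := Some (Suc (length w))), w @ a # num n @ num n)
        = (\<rho>', P', (w @ a # num n @ num n) @ u)"
      using IH by blast
    with traces.Step[of u n] fold_dstep_trace_Step[of n \<rho> P w] show ?thesis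
      unfolding 1 concat.simps fold_append comp_apply
      by (intro exI[of _ \<rho>'] exI[of _ P'] bexI[of _ "a # num n @ num n @ u"]) simp_all
  next
    case 2
    obtain \<rho>' P' u where "u \<in> traces"
      "fold dstep (concat ws) (\<rho>, P, w @ [b, b]) = (\<rho>', P', (w @ [b, b]) @ u)"
      using IH by blast
    with traces.Exit[of u] show ?thesis
      unfolding 2 by (intro exI[of _ \<rho>'] exI[of _ P'] bexI[of _ "b # b # u"]) simp_all
  qed
qed

lemma trace_records_complete:
  assumes "u \<in> traces"
  shows "\<exists>ws \<rho>' P'. set ws \<subseteq> reflang trace_record \<and>
    fold dstep (concat ws) (\<rho>, P, w) = (\<rho>', P', w @ u)"
  using assms
proof (induction arbitrary: \<rho> P w rule: traces.induct)
  case Nil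
  then show ?case
    by (intro exI[of _ "[]"]) auto
next
  case (Step u n)
  let ?v = "Tm a # Opn 0 # map Tm (num n) @ [Cls 0, Var 0]"
  obtain ws \<rho>' P' where ws: "set ws \<subseteq> reflang trace_record"
    "fold dstep (concat ws) (\<rho>(0 := num n), P(0 := Some (Suc (length w))), w @ a # num n @ num n)
      = (\<rho>', P', (w @ a # num n @ num n) @ u)"
    using Step.IH by blast
  have "set (?v # ws) \<subseteq> reflang trace_record"
    using ws(1) reflang_trace_record by auto
  moreover have "fold dstep (concat (?v # ws)) (\<rho>, P, w) = (\<rho>', P', w @ a # num n @ num n @ u)"
    using fold_dstep_trace_Step[of n \<rho> P w] ws(2)
    unfolding concat.simps fold_append comp_apply by simp
  ultimately show ?case
    by blast
next
  case (Exit u)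
  obtain ws \<rho>' P' where ws: "set ws \<subseteq> reflang trace_record"
    "fold dstep (concat ws) (\<rho>, P, w @ [b, b]) = (\<rho>', P', (w @ [b, b]) @ u)"
    using Exit.IH by blast
  have "set ([Tm b, Tm b] # ws) \<subseteq> reflang trace_record"
    using ws(1) reflang_trace_record by auto
  moreover have "fold dstep (concat ([Tm b, Tm b] # ws)) (\<rho>, P, w) = (\<rho>', P', w @ b # b # u)"
    using ws(2) by simp
  ultimately show ?case
    by blast
qed

lemma deref_fold: "fold dstep v (\<lambda>_. [], \<lambda>_. None, []) = (\<rho>, P, w) \<Longrightarrow> deref v = w"
  by (simp add: fold_dstep)

text \<open>\<open>Plus\<close> drops only the empty trace, which the input prefix never yields
  because it always writes a record.\<close>

lemma lang_check_regex: "lang check_regex = traces - {[]}"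
proof (intro equalityI subsetI)
  fix u assume "u \<in> lang check_regex"
  then obtain ws where ws: "ws \<noteq> []" "set ws \<subseteq> reflang trace_record" "u = deref (concat ws)"
    by (auto simp: lang_def check_regex_def lang_plus_def)
  obtain v ws' where "ws = v # ws'" "v \<in> reflang trace_record"
    using ws(1,2) by (cases ws) auto
  moreover have "\<exists>c v'. v = Tm c # v'" if "v \<in> reflang trace_record" for v
    using that unfolding reflang_trace_record by auto
  ultimately obtain c v' where "concat ws = Tm c # v'"
    by fastforce
  then obtain \<rho> P x where "fold dstep (concat ws) (\<lambda>_. [], \<lambda>_. None, []) = (\<rho>, P, [c] @ x)"
    using fold_dstep_extends[of v' "\<lambda>_. []" "\<lambda>_. None" "[c]"] by auto
  then have "u \<noteq> []"
    using deref_fold ws(3) by fastforce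
  moreover have "u \<in> traces"
    using trace_records_sound[OF ws(2)] deref_fold ws(3) by (metis append_Nil)
  ultimately show "u \<in> traces - {[]}"
    by simp
next
  fix u assume u: "u \<in> traces - {[]}"
  then obtain ws \<rho> P where ws: "set ws \<subseteq> reflang trace_record"
    "fold dstep (concat ws) (\<lambda>_. [], \<lambda>_. None, []) = (\<rho>, P, u)"
    using trace_records_complete[of u "\<lambda>_. []" "\<lambda>_. None" "[]"] by auto
  have "ws \<noteq> []"
    using ws(2) u by auto
  then have "concat ws \<in> reflang check_regex"
    using ws(1) by (auto simp: check_regex_def lang_plus_def)
  then show "u \<in> lang check_regex"
    using deref_fold[OF ws(2)] by (auto simp: lang_def)
qed

section \<open>Input and initial values\<close>

primrec num_regex :: "nat \<Rightarrow> ('a, nat) regex" where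
  "num_regex 0 = Sym b"
| "num_regex (Suc n) = Cat (Sym a) (num_regex n)"

text \<open>The input is written twice, like an assigned value, so that the checker accepts its
  record.\<close>

definition input_regex :: "nat \<Rightarrow> ('a, nat) regex \<Rightarrow> ('a, nat) regex" where
  "input_regex n \<alpha> = Cat (Cat (Sym a) (Cat (Bind 0 (num_regex n)) (Ref 0))) \<alpha>"

text \<open>Initialisation replaces the empty words of unbound variables by codes of zero. Register
  \<open>0\<close> is spared because it already holds the input. As this part does not depend on the
  input, it can belong to the regex whose number is the input.\<close>

primrec zeroing_regex :: "nat \<Rightarrow> ('a, nat) regex \<Rightarrow> ('a, nat) regex" where
  "zeroing_regex 0 \<alpha> = \<alpha>"
| "zeroing_regex (Suc k) \<alpha> = Cat (prog_regex (Assign (Suc k) Null)) (zeroing_regex k \<alpha>)"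

lemma reflang_num_regex: "reflang (num_regex n) = {map Tm (num n)}"
  by (induction n) (auto simp: conc_def)

lemma reflang_input_regex:
  "reflang (input_regex n \<alpha>) = (@) (Tm a # Opn 0 # map Tm (num n) @ [Cls 0, Var 0]) ` reflang \<alpha>"
  by (auto simp: input_regex_def conc_def reflang_num_regex)

text \<open>The word \<open>v\<^sub>0\<close> involves no choice, and its records compare
  \<open>num 0\<close> with itself, so they can be removed from or added to the front of any
  trace.\<close>

lemma zeroing_regex:
  "\<exists>v\<^sub>0. reflang (zeroing_regex k \<alpha>) = (@) v\<^sub>0 ` reflang \<alpha> \<and>
    (\<forall>\<rho> P w. \<exists>P' x. fold dstep v\<^sub>0 (\<rho>, P, w) = (\<lambda>r. if r \<in> {1..k} then num 0 else \<rho> r, P', w @ x) \<and>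
       (\<forall>z. x @ z \<in> traces \<longleftrightarrow> z \<in> traces))"
proof (induction k)
  case 0
  show ?case
    by (intro exI[of _ "[]"]) auto
next
  case (Suc k)
  then obtain v\<^sub>0 where v0: "reflang (zeroing_regex k \<alpha>) = (@) v\<^sub>0 ` reflang \<alpha>"
    "\<And>\<rho> P w. \<exists>P' x. fold dstep v\<^sub>0 (\<rho>, P, w) = (\<lambda>r. if r \<in> {1..k} then num 0 else \<rho> r, P', w @ x) \<and>
       (\<forall>z. x @ z \<in> traces \<longleftrightarrow> z \<in> traces)"
    by blast
  let ?v = "Tm a # Opn (Suc k) # map Tm (num 0) @ [Cls (Suc k), Var (Suc k)]"
  have "reflang (zeroing_regex (Suc k) \<alpha>) = (@) (?v @ v\<^sub>0) ` reflang \<alpha>"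
    using v0(1) by (auto simp: conc_def)
  moreover have "\<exists>P' x. fold dstep (?v @ v\<^sub>0) (\<rho>, P, w) =
      (\<lambda>r. if r \<in> {1..Suc k} then num 0 else \<rho> r, P', w @ x) \<and> (\<forall>z. x @ z \<in> traces \<longleftrightarrow> z \<in> traces)"
    for \<rho> P w
  proof -
    let ?w = "w @ a # num 0 @ num 0"
    obtain P' x where x: "fold dstep v\<^sub>0 (\<rho>(Suc k := num 0), P(Suc k := Some (Suc (length w))), ?w) =
        (\<lambda>r. if r \<in> {1..k} then num 0 else (\<rho>(Suc k := num 0)) r, P', ?w @ x)"
      "\<And>z. x @ z \<in> traces \<longleftrightarrow> z \<in> traces"
      using v0(2) by blast
    have "(\<lambda>r. if r \<in> {1..k} then num 0 else (\<rho>(Suc k := num 0)) r) =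
        (\<lambda>r. if r \<in> {1..Suc k} then num 0 else \<rho> r)"
      by (auto simp: fun_eq_iff)
    moreover have "(a # num 0 @ num 0 @ x) @ z \<in> traces \<longleftrightarrow> z \<in> traces" for z
      using x(2) traces_Step_iff[of 0 0 "x @ z"] by simp
    ultimately show ?thesis
      using x(1) fold_dstep_Assign[OF fold_dstep_terminals, of "Suc k" "num 0" \<rho> P w]
      unfolding fold_append comp_apply
      by (intro exI[of _ P'] exI[of _ "a # num 0 @ num 0 @ x"]) simp
  qed
  ultimately show ?case
    by blast
qed

lemma halting_iff_intersection:
  assumes "regs p \<subseteq> {..k}"
  shows "lang (input_regex n (zeroing_regex k (prog_regex p))) \<inter> lang check_regex \<noteq> {} \<longleftrightarrow>
    (\<exists>\<sigma>. exec p ((\<lambda>_. 0)(0 := n)) \<sigma>)"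
proof -
  let ?\<sigma> = "(\<lambda>_. 0)(0 := n) :: store"
  from zeroing_regex[of k "prog_regex p"] obtain v\<^sub>0 where v0: "reflang (zeroing_regex k (prog_regex p)) = (@) v\<^sub>0 ` reflang (prog_regex p)"
    "\<And>\<rho> P w. \<exists>P' x. fold dstep v\<^sub>0 (\<rho>, P, w) = (\<lambda>r. if r \<in> {1..k} then num 0 else \<rho> r, P', w @ x) \<and>
       (\<forall>z. x @ z \<in> traces \<longleftrightarrow> z \<in> traces)"
    by (elim exE conjE) (rule that, assumption, elim allE)
  define v\<^sub>1 where "v\<^sub>1 = (Tm a # Opn 0 # map Tm (num n) @ [Cls 0, Var 0]) @ v\<^sub>0"
  let ?w = "a # num n @ num n"
  obtain P x where x: "fold dstep v\<^sub>0 ((\<lambda>_. [])(0 := num n), (\<lambda>_. None)(0 := Some (Suc 0)), ?w) =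
      (\<lambda>r. if r \<in> {1..k} then num 0 else ((\<lambda>_. [])(0 := num n)) r, P, ?w @ x)"
    "\<forall>z. x @ z \<in> traces \<longleftrightarrow> z \<in> traces"
    using v0(2)[of "(\<lambda>_. [])(0 := num n)" "(\<lambda>_. None)(0 := Some (Suc 0))" ?w]
    by (elim exE conjE) (rule that)
  define \<rho> where "\<rho> = (\<lambda>r. if r \<in> {1..k} then num 0 else ((\<lambda>_. [])(0 := num n)) r)"
  have rep: "represents {..k} \<rho> ?\<sigma>"
    by (simp add: represents_def \<rho>_def)
  have lang: "lang (input_regex n (zeroing_regex k (prog_regex p))) =
      (\<lambda>v. deref (v\<^sub>1 @ v)) ` reflang (prog_regex p)"
    by (simp add: lang_def reflang_input_regex v0(1) image_image v\<^sub>1_def)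
  \<comment> \<open>All output written before the program starts: nonempty, and transparent to the
    checker.\<close>
  define y where "y = ?w @ x"
  have input: "fold dstep (Tm a # Opn 0 # map Tm (num n) @ [Cls 0, Var 0]) (\<lambda>_. [], \<lambda>_. None, []) =
      ((\<lambda>_. [])(0 := num n), (\<lambda>_. None)(0 := Some (Suc 0)), ?w)"
    unfolding fold_dstep_trace_Step by simp
  have v1: "fold dstep (v\<^sub>1 @ v) (\<lambda>_. [], \<lambda>_. None, []) = fold dstep v (\<rho>, P, y)" for v
    unfolding v\<^sub>1_def fold_append comp_apply input x(1) \<rho>_def y_def ..
  have y: "y @ z \<in> traces \<longleftrightarrow> z \<in> traces" for z
    using x(2) traces_Step_iff[of n n "x @ z"] by (simp add: y_def)
  show ?thesis
  proof
    assume "lang (input_regex n (zeroing_regex k (prog_regex p))) \<inter> lang check_regex \<noteq> {}"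
    then obtain v where v: "v \<in> reflang (prog_regex p)" "deref (v\<^sub>1 @ v) \<in> traces"
      unfolding lang lang_check_regex by auto
    from fold_dstep_extends[of v \<rho> P y] obtain \<rho>' P' u where
      u: "fold dstep v (\<rho>, P, y) = (\<rho>', P', y @ u)"
      by (elim exE)
    then have "deref (v\<^sub>1 @ v) = y @ u"
      by (intro deref_fold) (simp only: v1)
    with v(2) have "u @ [] \<in> traces"
      by (simp add: y)
    from prog_regex_sound[OF v(1) assms rep u this] show "\<exists>\<sigma>. exec p ?\<sigma> \<sigma>"
      by blast
  next
    assume "\<exists>\<sigma>. exec p ?\<sigma> \<sigma>"
    then obtain \<sigma> where "exec p ?\<sigma> \<sigma>" ..
    from prog_regex_complete[OF this assms rep, of P y] obtain v \<rho>' P' u where v: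
      "v \<in> reflang (prog_regex p)" "fold dstep v (\<rho>, P, y) = (\<rho>', P', y @ u)"
      "\<forall>z\<in>traces. u @ z \<in> traces"
      by (elim bexE exE conjE)
    have "deref (v\<^sub>1 @ v) = y @ u"
      by (intro deref_fold) (simp only: v1 v(2))
    moreover have "u \<in> traces"
      using bspec[OF v(3) traces.Nil] by simp
    then have "y @ u \<in> traces - {[]}"
      by (simp add: y) (simp add: y_def)
    ultimately have "y @ u \<in> lang (input_regex n (zeroing_regex k (prog_regex p))) \<inter> lang check_regex"
      unfolding lang lang_check_regex using v(1) by (metis IntI imageI)
    then show "lang (input_regex n (zeroing_regex k (prog_regex p))) \<inter> lang check_regex \<noteq> {}"
      by blast
  qed
qed

section \<open>Determinism of the constructed regex\<close>

lemma branching_any_num: "branching_regex False any_num"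
  unfolding any_num_def
  by (rule branching_regex_Star_Cat[where A = "{a}" and B = "{b}"]) (use ab in auto)

text \<open>All choices sit in stars: a guess goes on with \<open>a\<close> and stops with
  \<open>b\<close>, and a loop starts an iteration with \<open>a\<close> and exits with
  \<open>b\<close>.\<close>

lemma branching_prog_regex: "branching_regex False (prog_regex p)"
proof (induction p)
  case (Assign r e)
  have "branching_regex False (rhs_regex e)"
    by (cases e) (auto intro: branching_regex_Cat)
  then show ?case
    by (auto intro!: branching_regex_Cat branching_regex_Bind)
next
  case (Seq p q)
  then show ?case
    by (auto intro: branching_regex_Cat)
next
  case (Loop r s p)
  show ?case
    unfolding prog_regex.simps
    by (rule branching_regex_Star_Cat[where A = "{a}" and B = "{b}"])
      (use ab Loop in \<open>auto intro!: branching_regex_Cat branching_regex_Bind branching_any_num\<close>)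
qed

lemma branching_num_regex: "branching_regex False (num_regex n)"
  by (induction n) (auto intro: branching_regex_Cat)

lemma branching_zeroing_regex:
  "branching_regex e \<alpha> \<Longrightarrow> branching_regex e (zeroing_regex k \<alpha>)"
proof (induction k)
  case (Suc k)
  show ?case
    unfolding zeroing_regex.simps
    by (intro branching_regex_Cat branching_prog_regex Suc.IH Suc.prems)
qed simp

lemma branching_input_regex: "branching_regex e \<alpha> \<Longrightarrow> branching_regex e (input_regex n \<alpha>)"
  unfolding input_regex_def
  by (intro branching_regex_Cat branching_regex_Bind branching_num_regex) simp_all

lemma var_num_regex: "var (num_regex n) = {}"
  by (induction n) auto

lemma var_any_num: "var any_num = {}"
  by (simp add: any_num_def)

lemma nonempty_num_regex: "is_nonempty_regex (num_regex n)"
  by (induction n) auto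

lemma nonempty_any_num: "is_nonempty_regex any_num"
  by (simp add: any_num_def)

lemma nonempty_prog_regex: "wf_prog p \<Longrightarrow> is_nonempty_regex (prog_regex p)"
proof (induction p)
  case (Assign r e)
  then show ?case by (cases e) auto
qed (auto simp: var_any_num nonempty_any_num)

lemma nonempty_zeroing_regex:
  "is_nonempty_regex \<alpha> \<Longrightarrow> is_nonempty_regex (zeroing_regex k \<alpha>)"
  by (induction k) auto

lemma deterministic_input_regex:
  assumes "wf_prog p"
  shows "deterministic_regex (input_regex n (zeroing_regex k (prog_regex p)))"
proof (rule deterministic_regexI)
  show "is_nonempty_regex (input_regex n (zeroing_regex k (prog_regex p)))"
    using nonempty_zeroing_regex[OF nonempty_prog_regex[OF assms]]
    by (simp add: input_regex_def var_num_regex nonempty_num_regex)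
  show "branching_regex True (input_regex n (zeroing_regex k (prog_regex p)))"
    using branching_input_regex branching_zeroing_regex branching_prog_regex branching_regex_mono
    by blast
qed

lemma deterministic_check_regex: "deterministic_regex check_regex"
proof (rule deterministic_regexI)
  show "is_nonempty_regex check_regex"
    by (simp add: check_regex_def trace_record_def var_any_num nonempty_any_num)
  have "branching_regex False trace_record"
    unfolding trace_record_def
    by (rule branching_regex_Alt[where A = "{a}" and B = "{b}"])
      (use ab in \<open>auto intro!: branching_regex_Cat branching_regex_Bind branching_any_num\<close>)
  moreover have "starts_with ({a} \<union> {b}) trace_record"
    unfolding trace_record_def by (intro starts_with_Alt) simp_all
  ultimately show "branching_regex True check_regex"
    unfolding check_regex_def by (rule branching_regex_Plus)
qed

end

section \<open>Partial recursive functions as while programs\<close>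

inductive_cases exec_AssignE: "exec (Assign r e) \<sigma> \<sigma>'"
inductive_cases exec_SeqE: "exec (Seq p q) \<sigma> \<sigma>'"

lemma exec_Assign_iff: "exec (Assign r e) \<sigma> \<sigma>' \<longleftrightarrow> \<sigma>' = \<sigma>(r := rhs_val e \<sigma>)"
  by (auto intro: exec.Assign elim: exec_AssignE)

lemma exec_Seq_iff: "exec (Seq p q) \<sigma> \<sigma>' \<longleftrightarrow> (\<exists>\<tau>. exec p \<sigma> \<tau> \<and> exec q \<tau> \<sigma>')"
  by (auto intro: exec.Seq elim: exec_SeqE)

lemma Loop_sound:
  assumes "exec (Loop r s p) \<sigma> \<sigma>'" "I \<sigma>"
    and "\<And>\<sigma> n \<tau>. I \<sigma> \<Longrightarrow> \<sigma> r = Suc n \<Longrightarrow> exec p (\<sigma>(s := n)) \<tau> \<Longrightarrow> I \<tau>"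
  shows "I \<sigma>' \<and> \<sigma>' r = 0"
  using assms(1,2)
proof (induction "Loop r s p" \<sigma> \<sigma>' rule: exec.induct)
  case (Loop_step \<sigma> n \<tau> \<sigma>')
  then show ?case using assms(3) by blast
qed simp

lemma Loop_complete:
  fixes \<mu> :: "store \<Rightarrow> nat"
  assumes "I \<sigma>"
    and step: "\<And>\<sigma> n. I \<sigma> \<Longrightarrow> \<sigma> r = Suc n \<Longrightarrow> \<exists>\<tau>. exec p (\<sigma>(s := n)) \<tau> \<and> I \<tau> \<and> \<mu> \<tau> < \<mu> \<sigma>"
  shows "\<exists>\<sigma>'. exec (Loop r s p) \<sigma> \<sigma>'"
  using assms(1)
proof (induction "\<mu> \<sigma>" arbitrary: \<sigma> rule: less_induct)
  case less
  show ?case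
  proof (cases "\<sigma> r")
    case 0
    then show ?thesis by (blast intro: exec.Loop_exit)
  next
    case (Suc n)
    from step[OF less.prems this] obtain \<tau> where
      \<tau>: "exec p (\<sigma>(s := n)) \<tau>" "I \<tau>" "\<mu> \<tau> < \<mu> \<sigma>" by blast
    from less.hyps[OF \<tau>(3,2)] obtain \<sigma>' where "exec (Loop r s p) \<tau> \<sigma>'" ..
    with exec.Loop_step[of \<sigma> r n p s, OF Suc \<tau>(1)] show ?thesis by blast
  qed
qed

text \<open>The registers from \<open>m\<close> on are scratch space.\<close>

definition realizes :: "recf \<Rightarrow> nat list \<Rightarrow> nat \<Rightarrow> nat \<Rightarrow> prog \<Rightarrow> bool" where
  "realizes f rs out m p \<longleftrightarrow> wf_prog p \<and>
     (\<forall>\<sigma> \<sigma>'. exec p \<sigma> \<sigma>' \<longrightarrow>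
        computes f (map \<sigma> rs) (\<sigma>' out) \<and> (\<forall>r<m. r \<noteq> out \<longrightarrow> \<sigma>' r = \<sigma> r)) \<and>
     (\<forall>\<sigma> y. computes f (map \<sigma> rs) y \<longrightarrow> (\<exists>\<sigma>'. exec p \<sigma> \<sigma>'))"

lemma realizesI:
  assumes "wf_prog p"
    and "\<And>\<sigma> \<sigma>'. exec p \<sigma> \<sigma>' \<Longrightarrow> computes f (map \<sigma> rs) (\<sigma>' out)"
    and "\<And>\<sigma> \<sigma>' r. exec p \<sigma> \<sigma>' \<Longrightarrow> r < m \<Longrightarrow> r \<noteq> out \<Longrightarrow> \<sigma>' r = \<sigma> r"
    and "\<And>\<sigma> y. computes f (map \<sigma> rs) y \<Longrightarrow> \<exists>\<sigma>'. exec p \<sigma> \<sigma>'"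
  shows "realizes f rs out m p"
  using assms unfolding realizes_def by blast

lemma realizesD:
  assumes "realizes f rs out m p"
  shows "wf_prog p"
    and "exec p \<sigma> \<sigma>' \<Longrightarrow> computes f (map \<sigma> rs) (\<sigma>' out)"
    and "exec p \<sigma> \<sigma>' \<Longrightarrow> r < m \<Longrightarrow> r \<noteq> out \<Longrightarrow> \<sigma>' r = \<sigma> r"
    and "computes f (map \<sigma> rs) y \<Longrightarrow> \<exists>\<sigma>'. exec p \<sigma> \<sigma>'"
  using assms unfolding realizes_def by blast+

text \<open>A compiled part must fit any caller, which chooses the argument registers, the result
  register and the protected ones. The result is kept apart from the arguments because assignments
  such as \<open>Assign out (Next r)\<close> are well-formed only then.\<close>

definition realizable :: "recf \<Rightarrow> bool" where
  "realizable f \<longleftrightarrow> (\<forall>rs out m. set rs \<subseteq> {..<m} \<longrightarrow> out < m \<longrightarrow> out \<notin> set rs \<longrightarrow>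
     (\<exists>p. realizes f rs out m p))"

lemma realizableE:
  assumes "realizable f" "set rs \<subseteq> {..<m}" "out < m" "out \<notin> set rs"
  obtains p where "realizes f rs out m p"
  using assms unfolding realizable_def by blast

lemma diverging_prog: "\<exists>p. wf_prog p \<and> (\<forall>\<sigma> \<sigma>'. \<not> exec p \<sigma> \<sigma>')"
proof (intro exI conjI allI notI)
  \<comment> \<open>The predecessor goes to register \<open>1\<close>, so register \<open>0\<close>
    is never lowered.\<close>
  let ?loop = "Loop 0 1 (Assign 1 Null)"
  let ?p = "Seq (Assign 1 Null) (Seq (Assign 0 (Next 1)) ?loop)"
  show "wf_prog ?p" by simp
  fix \<sigma> \<sigma>' assume "exec ?p \<sigma> \<sigma>'"
  then obtain \<tau> where \<tau>: "exec ?loop \<tau> \<sigma>'" "\<tau> 0 = Suc 0"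
    by (auto simp: exec_Seq_iff exec_Assign_iff)
  have "\<sigma>' 0 = Suc 0 \<and> \<sigma>' 0 = 0"
    by (rule Loop_sound[where I = "\<lambda>\<sigma>. \<sigma> 0 = Suc 0", OF \<tau>]) (simp add: exec_Assign_iff)
  then show False by auto
qed

text \<open>As arities are not tracked, some applications have no value at all; they are compiled to
  divergence.\<close>

lemma realizes_undefined:
  assumes "\<And>\<sigma> y. \<not> computes f (map \<sigma> rs) y"
  shows "\<exists>p. realizes f rs out m p"
  using diverging_prog assms unfolding realizes_def by blast

section \<open>Compilation of composition, primitive recursion and minimisation\<close>

inductive_cases computes_SuccE: "computes Succ xs y"
inductive_cases computes_ProjE: "computes (Proj i) xs y"
inductive_cases computes_CompE: "computes (Comp f gs) xs y"
inductive_cases computes_Prec_NilE: "computes (Prec f g) [] y"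
inductive_cases computes_Prec_0E: "computes (Prec f g) (0 # xs) y"
inductive_cases computes_Prec_SucE: "computes (Prec f g) (Suc n # xs) y"
inductive_cases computes_MuE: "computes (Mu f) xs y"

text \<open>A derivation for \<open>k\<close> contains one for every smaller \<open>j\<close>; this
  provides termination for each round of the compiled loop.\<close>

lemma Prec_defined_below:
  assumes "computes (Prec f g) (k # xs) y" "j \<le> k"
  shows "\<exists>w. computes (Prec f g) (j # xs) w"
  using assms
proof (induction k arbitrary: y)
  case (Suc k)
  show ?case
  proof (cases "j = Suc k")
    case False
    with Suc show ?thesis by (auto elim!: computes_Prec_SucE)
  qed (use Suc.prems in blast)
qed auto

lemma list_all2_computes_functional:
  assumes "list_all2 (\<lambda>g y. computes g xs y) gs ys" "list_all2 (\<lambda>g y. computes g xs y) gs zs"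
  shows "ys = zs"
  using assms unfolding list_all2_conv_all_nth
  by (intro nth_equalityI) (auto, metis computes_functional)

text \<open>Induction from the right end puts the results into consecutive registers from
  \<open>m\<close> on. Each new program has all earlier results below its scratch bound and so
  preserves them.\<close>

lemma realizes_args:
  assumes "\<forall>g\<in>set gs. realizable g" and "set rs \<subseteq> {..<m}"
  shows "\<exists>p. wf_prog p \<and>
    (\<forall>\<sigma> \<sigma>'. exec p \<sigma> \<sigma>' \<longrightarrow>
       list_all2 (\<lambda>g y. computes g (map \<sigma> rs) y) gs (map \<sigma>' [m..<m + length gs]) \<and>
       (\<forall>r<m. \<sigma>' r = \<sigma> r)) \<and>
    (\<forall>\<sigma> ys. list_all2 (\<lambda>g y. computes g (map \<sigma> rs) y) gs ys \<longrightarrow> (\<exists>\<sigma>'. exec p \<sigma> \<sigma>'))"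
  using assms(1)
proof (induction gs rule: rev_induct)
  case Nil
  \<comment> \<open>There is no skip command; writing to the scratch register \<open>m\<close>
    replaces it.\<close>
  show ?case
    by (intro exI[of _ "Assign m Null"]) (auto simp: exec_Assign_iff)
next
  case (snoc g gs)
  let ?l = "m + length gs"
  have "\<forall>g\<in>set gs. realizable g"
    using snoc.prems by simp
  from snoc.IH[OF this] obtain p where p: "wf_prog p"
    "\<forall>\<sigma> \<sigma>'. exec p \<sigma> \<sigma>' \<longrightarrow>
       list_all2 (\<lambda>g y. computes g (map \<sigma> rs) y) gs (map \<sigma>' [m..<?l]) \<and> (\<forall>r<m. \<sigma>' r = \<sigma> r)"
    "\<forall>\<sigma> ys. list_all2 (\<lambda>g y. computes g (map \<sigma> rs) y) gs ys \<longrightarrow> (\<exists>\<sigma>'. exec p \<sigma> \<sigma>')"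
    by (elim exE conjE)
  note p_args = p(2)[rule_format, THEN conjunct1] and p_keeps = p(2)[rule_format, THEN conjunct2, rule_format]
  have "?l \<notin> set rs" "set rs \<subseteq> {..<Suc ?l}"
    using assms(2) by force+
  then obtain q where q: "realizes g rs ?l (Suc ?l) q"
    using snoc.prems realizableE[of g rs "Suc ?l" ?l] by auto
  have rs: "map \<tau> rs = map \<sigma> rs" if "exec p \<sigma> \<tau>" for \<sigma> \<tau>
    using p_keeps[OF that] assms(2) by auto
  show ?case
  proof (intro exI[of _ "Seq p q"] conjI allI impI)
    show "wf_prog (Seq p q)"
      using p(1) realizesD(1)[OF q] by simp
  next
    fix \<sigma> \<sigma>' assume "exec (Seq p q) \<sigma> \<sigma>'"
    then obtain \<tau> where \<tau>: "exec p \<sigma> \<tau>" "exec q \<tau> \<sigma>'"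
      by (auto simp: exec_Seq_iff)
    have "map \<sigma>' [m..<?l] = map \<tau> [m..<?l]"
      using realizesD(3)[OF q \<tau>(2)] by auto
    moreover have "computes g (map \<sigma> rs) (\<sigma>' ?l)"
      using realizesD(2)[OF q \<tau>(2)] rs[OF \<tau>(1)] by simp
    ultimately show "list_all2 (\<lambda>g y. computes g (map \<sigma> rs) y) (gs @ [g])
        (map \<sigma>' [m..<m + length (gs @ [g])])"
      using p_args[OF \<tau>(1)] by (simp add: list_all2_append del: map_eq_conv)
    fix r assume "r < m"
    then show "\<sigma>' r = \<sigma> r"
      using realizesD(3)[OF q \<tau>(2), of r] p_keeps[OF \<tau>(1), of r] by simp
  next
    fix \<sigma> ys assume "list_all2 (\<lambda>g y. computes g (map \<sigma> rs) y) (gs @ [g]) ys"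
    then obtain ys' y where ys: "list_all2 (\<lambda>g y. computes g (map \<sigma> rs) y) gs ys'"
      "computes g (map \<sigma> rs) y"
      by (auto simp: list_all2_append1 list_all2_Cons1)
    from p(3)[rule_format, OF ys(1)] obtain \<tau> where \<tau>: "exec p \<sigma> \<tau>" ..
    from ys(2) have "computes g (map \<tau> rs) y"
      unfolding rs[OF \<tau>] .
    from realizesD(4)[OF q this] \<tau> show "\<exists>\<sigma>'. exec (Seq p q) \<sigma> \<sigma>'"
      unfolding exec_Seq_iff by blast
  qed
qed

lemma realizes_Comp:
  assumes args: "\<forall>g\<in>set gs. realizable g" and "realizable f"
    and "set rs \<subseteq> {..<m}" "out < m" "out \<notin> set rs"
  shows "\<exists>p. realizes (Comp f gs) rs out m p"
proof -
  let ?l = "m + length gs"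
  from realizes_args[OF args assms(3)] obtain p where p: "wf_prog p"
    "\<forall>\<sigma> \<sigma>'. exec p \<sigma> \<sigma>' \<longrightarrow>
       list_all2 (\<lambda>g y. computes g (map \<sigma> rs) y) gs (map \<sigma>' [m..<?l]) \<and> (\<forall>r<m. \<sigma>' r = \<sigma> r)"
    "\<forall>\<sigma> ys. list_all2 (\<lambda>g y. computes g (map \<sigma> rs) y) gs ys \<longrightarrow> (\<exists>\<sigma>'. exec p \<sigma> \<sigma>')"
    by (elim exE conjE)
  note p_args = p(2)[rule_format, THEN conjunct1] and p_keeps = p(2)[rule_format, THEN conjunct2, rule_format]
  obtain q where q: "realizes f [m..<?l] out ?l q"
    by (rule realizableE[OF assms(2), of "[m..<?l]" ?l out]) (use assms(4) in auto)
  have "realizes (Comp f gs) rs out m (Seq p q)"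
  proof (rule realizesI)
    show "wf_prog (Seq p q)"
      using p(1) realizesD(1)[OF q] by simp
  next
    fix \<sigma> \<sigma>' assume "exec (Seq p q) \<sigma> \<sigma>'"
    then obtain \<tau> where \<tau>: "exec p \<sigma> \<tau>" "exec q \<tau> \<sigma>'"
      by (auto simp: exec_Seq_iff)
    show "computes (Comp f gs) (map \<sigma> rs) (\<sigma>' out)"
      using p_args[OF \<tau>(1)] realizesD(2)[OF q \<tau>(2)] by (rule computes.comp)
    fix r assume "r < m" "r \<noteq> out"
    then show "\<sigma>' r = \<sigma> r"
      using realizesD(3)[OF q \<tau>(2), of r] p_keeps[OF \<tau>(1), of r] by simp
  next
    fix \<sigma> y assume "computes (Comp f gs) (map \<sigma> rs) y"
    then obtain ys where ys: "list_all2 (\<lambda>g y. computes g (map \<sigma> rs) y) gs ys" "computes f ys y"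
      by (auto elim: computes_CompE)
    from p(3)[rule_format, OF ys(1)] obtain \<tau> where \<tau>: "exec p \<sigma> \<tau>" ..
    have "map \<tau> [m..<?l] = ys"
      using p_args[OF \<tau>] ys(1) by (rule list_all2_computes_functional)
    with ys(2) have "computes f (map \<tau> [m..<?l]) y"
      by (simp only:)
    from realizesD(4)[OF q this] \<tau> show "\<exists>\<sigma>'. exec (Seq p q) \<sigma> \<sigma>'"
      unfolding exec_Seq_iff by blast
  qed
  then show ?thesis ..
qed

lemma realizes_Prec:
  assumes f: "realizes f rs (m + 1) (m + 5) p"
    and g: "realizes g (m # (m + 1) # rs) (m + 3) (m + 5) q"
    and rs: "set (r # rs) \<subseteq> {..<m}" and out: "out < m"
  shows "\<exists>p. realizes (Prec f g) (r # rs) out m p"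
proof -
  \<comment> \<open>Stage, value reached, rounds left, next value, and a copy of the stage, since
    \<open>Assign ?c (Next ?c)\<close> is ill-formed. The bound \<open>m + 5\<close> protects all
    five from \<open>p\<close> and \<open>q\<close>, except for their own results. Stage and rounds
    left always add up to the argument.\<close>
  let ?c = "m" and ?y = "m + 1" and ?t = "m + 2" and ?z = "m + 3" and ?c' = "m + 4"
  define body where "body =
    Seq q (Seq (Assign ?y (Same ?z)) (Seq (Assign ?c' (Next ?c)) (Assign ?c (Same ?c'))))"
  define loop where "loop = Loop ?t ?t body"
  define prog where "prog = Seq p (Seq (Assign ?c Null) (Seq (Assign ?t (Same r))
    (Seq loop (Assign out (Same ?y)))))"
  define inv where "inv \<sigma>\<^sub>0 \<sigma> \<longleftrightarrow>
      computes (Prec f g) (\<sigma> ?c # map \<sigma>\<^sub>0 rs) (\<sigma> ?y) \<and> \<sigma> ?c + \<sigma> ?t = \<sigma>\<^sub>0 r \<and> (\<forall>i<m. \<sigma> i = \<sigma>\<^sub>0 i)"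
    for \<sigma>\<^sub>0 \<sigma> :: store
  have map_rs: "map \<sigma> rs = map \<sigma>\<^sub>0 rs" if "\<forall>i<m. \<sigma> i = \<sigma>\<^sub>0 i" for \<sigma> \<sigma>\<^sub>0 :: store
    using that rs by auto
  have exec_body: "exec body \<sigma> \<tau> \<longleftrightarrow>
      (\<exists>\<upsilon>. exec q \<sigma> \<upsilon> \<and> \<tau> = \<upsilon>(?y := \<upsilon> ?z, ?c' := Suc (\<upsilon> ?c), ?c := Suc (\<upsilon> ?c)))" for \<sigma> \<tau>
    by (simp add: body_def exec_Seq_iff exec_Assign_iff)
  have step: "inv \<sigma>\<^sub>0 \<tau> \<and> \<tau> ?t = n"
    if I: "inv \<sigma>\<^sub>0 \<sigma>" and t: "\<sigma> ?t = Suc n" and ex: "exec body (\<sigma>(?t := n)) \<tau>" for \<sigma>\<^sub>0 \<sigma> n \<tau>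
  proof -
    from ex obtain \<upsilon> where \<upsilon>: "exec q (\<sigma>(?t := n)) \<upsilon>"
      "\<tau> = \<upsilon>(?y := \<upsilon> ?z, ?c' := Suc (\<upsilon> ?c), ?c := Suc (\<upsilon> ?c))"
      unfolding exec_body by blast
    have eq: "\<upsilon> i = (\<sigma>(?t := n)) i" if "i < m + 5" "i \<noteq> ?z" for i
      using realizesD(3)[OF g \<upsilon>(1)] that by blast
    have "map (\<sigma>(?t := n)) rs = map \<sigma>\<^sub>0 rs"
      using I by (intro map_rs) (auto simp: inv_def)
    with realizesD(2)[OF g \<upsilon>(1)] have "computes g (\<sigma> ?c # \<sigma> ?y # map \<sigma>\<^sub>0 rs) (\<upsilon> ?z)"
      by (simp del: map_eq_conv)
    with I have "computes (Prec f g) (Suc (\<sigma> ?c) # map \<sigma>\<^sub>0 rs) (\<upsilon> ?z)"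
      unfolding inv_def by (blast intro: computes.prec_Suc)
    with I t eq show ?thesis
      by (auto simp: inv_def \<upsilon>(2))
  qed
  have init: "inv \<sigma>\<^sub>0 (\<tau>(?c := 0, ?t := \<tau> r))" if "exec p \<sigma>\<^sub>0 \<tau>" for \<sigma>\<^sub>0 \<tau>
    using realizesD(2)[OF f that] realizesD(3)[OF f that] rs
    by (auto simp: inv_def intro: computes.prec_0)
  have exec_prog: "exec prog \<sigma> \<sigma>' \<longleftrightarrow> (\<exists>\<tau> \<upsilon>. exec p \<sigma> \<tau> \<and> exec loop (\<tau>(?c := 0, ?t := \<tau> r)) \<upsilon> \<and>
      \<sigma>' = \<upsilon>(out := \<upsilon> ?y))" for \<sigma> \<sigma>'
    using rs by (simp add: prog_def exec_Seq_iff exec_Assign_iff)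
  have "realizes (Prec f g) (r # rs) out m prog"
  proof (rule realizesI)
    show "wf_prog prog"
      using realizesD(1)[OF f] realizesD(1)[OF g] rs out
      by (simp add: prog_def loop_def body_def)
  next
    fix \<sigma> \<sigma>' assume "exec prog \<sigma> \<sigma>'"
    then obtain \<tau> \<upsilon> where *: "exec p \<sigma> \<tau>" "exec loop (\<tau>(?c := 0, ?t := \<tau> r)) \<upsilon>" "\<sigma>' = \<upsilon>(out := \<upsilon> ?y)"
      unfolding exec_prog by blast
    have "inv \<sigma> \<upsilon> \<and> \<upsilon> ?t = 0"
      by (rule Loop_sound[where I = "inv \<sigma>", OF *(2)[unfolded loop_def] init[OF *(1)]])
        (rule step[THEN conjunct1]; assumption)
    then show "computes (Prec f g) (map \<sigma> (r # rs)) (\<sigma>' out)"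
      and "\<And>i. i < m \<Longrightarrow> i \<noteq> out \<Longrightarrow> \<sigma>' i = \<sigma> i"
      using *(3) out by (auto simp: inv_def)
  next
    fix \<sigma> y assume y: "computes (Prec f g) (map \<sigma> (r # rs)) y"
    then have below: "\<exists>w. computes (Prec f g) (j # map \<sigma> rs) w" if "j \<le> \<sigma> r" for j
      using Prec_defined_below that by simp
    from below[of 0] obtain w where "computes f (map \<sigma> rs) w"
      by (auto elim: computes_Prec_0E)
    from realizesD(4)[OF f this] obtain \<tau> where \<tau>: "exec p \<sigma> \<tau>" ..
    have "\<exists>\<upsilon>. exec loop (\<tau>(?c := 0, ?t := \<tau> r)) \<upsilon>"
      unfolding loop_def
    proof (rule Loop_complete[where I = "inv \<sigma>" and \<mu> = "\<lambda>\<sigma>. \<sigma> ?t"])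
      show "inv \<sigma> (\<tau>(?c := 0, ?t := \<tau> r))"
        by (rule init[OF \<tau>])
    next
      fix \<upsilon> n assume I: "inv \<sigma> \<upsilon>" and t: "\<upsilon> ?t = Suc n"
      then have "Suc (\<upsilon> ?c) \<le> \<sigma> r"
        by (simp add: inv_def)
      from below[OF this] obtain w where "computes (Prec f g) (Suc (\<upsilon> ?c) # map \<sigma> rs) w" ..
      then obtain v where
        v: "computes (Prec f g) (\<upsilon> ?c # map \<sigma> rs) v" "computes g (\<upsilon> ?c # v # map \<sigma> rs) w"
        by (rule computes_Prec_SucE)
      \<comment> \<open>The recursion provides a value of \<open>g\<close> at its own previous
        result \<open>v\<close>; functionality identifies \<open>v\<close> with the stored
        one.\<close>
      have "v = \<upsilon> ?y"
        using v(1) by (rule computes_functional) (use I in \<open>simp add: inv_def\<close>)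
      with v(2) have "computes g (\<upsilon> ?c # \<upsilon> ?y # map \<sigma> rs) w"
        by simp
      moreover have "map (\<upsilon>(?t := n)) rs = map \<sigma> rs"
        using I by (intro map_rs) (auto simp: inv_def)
      ultimately have "computes g (map (\<upsilon>(?t := n)) (m # (m + 1) # rs)) w"
        by (simp del: map_eq_conv)
      from realizesD(4)[OF g this] obtain \<tau>' where "exec q (\<upsilon>(?t := n)) \<tau>'" ..
      then obtain \<tau>'' where ex: "exec body (\<upsilon>(?t := n)) \<tau>''"
        unfolding exec_body by blast
      with step[OF I t ex] t show "\<exists>\<tau>'. exec body (\<upsilon>(?t := n)) \<tau>' \<and> inv \<sigma> \<tau>' \<and> \<tau>' ?t < \<upsilon> ?t"
        by auto
    qed
    then obtain \<upsilon> where "exec loop (\<tau>(?c := 0, ?t := \<tau> r)) \<upsilon>" ..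
    with \<tau> have "exec prog \<sigma> (\<upsilon>(out := \<upsilon> ?y))"
      unfolding exec_prog by blast
    then show "\<exists>\<sigma>'. exec prog \<sigma> \<sigma>'" by blast
  qed
  then show ?thesis ..
qed

lemma realizes_Mu:
  assumes f: "realizes f (m # rs) (m + 1) (m + 3) p"
    and rs: "set rs \<subseteq> {..<m}" and out: "out < m"
  shows "\<exists>p. realizes (Mu f) rs out m p"
proof -
  \<comment> \<open>Candidate, value of \<open>f\<close> there, and a copy for the increment. The
    loop destroys the value it tests, but \<open>p\<close> recomputes it for the next
    candidate.\<close>
  let ?c = "m" and ?y = "m + 1" and ?c' = "m + 2"
  define body where "body = Seq (Assign ?c' (Next ?c)) (Seq (Assign ?c (Same ?c')) p)"
  define loop where "loop = Loop ?y ?y body"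
  define prog where "prog = Seq (Assign ?c Null) (Seq p (Seq loop (Assign out (Same ?c))))"
  define inv where "inv \<sigma>\<^sub>0 \<sigma> \<longleftrightarrow>
      computes f (\<sigma> ?c # map \<sigma>\<^sub>0 rs) (\<sigma> ?y) \<and>
      (\<forall>j<\<sigma> ?c. \<exists>k. computes f (j # map \<sigma>\<^sub>0 rs) (Suc k)) \<and> (\<forall>i<m. \<sigma> i = \<sigma>\<^sub>0 i)"
    for \<sigma>\<^sub>0 \<sigma> :: store
  have map_rs: "map \<sigma> rs = map \<sigma>\<^sub>0 rs" if "\<forall>i<m. \<sigma> i = \<sigma>\<^sub>0 i" for \<sigma> \<sigma>\<^sub>0 :: store
    using that rs by auto
  have run_p: "computes f (n # map \<sigma>\<^sub>0 rs) (\<tau> ?y) \<and> \<tau> ?c = n \<and> (\<forall>i<m. \<tau> i = \<sigma>\<^sub>0 i)"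
    if "exec p \<sigma> \<tau>" "\<sigma> ?c = n" "\<forall>i<m. \<sigma> i = \<sigma>\<^sub>0 i" for \<sigma>\<^sub>0 \<sigma> \<tau> n
    using realizesD(2)[OF f that(1)] realizesD(3)[OF f that(1)] map_rs[OF that(3)] that(2,3)
    by (simp del: map_eq_conv)
  have run_p': "\<exists>\<tau>. exec p \<sigma> \<tau>"
    if "computes f (n # map \<sigma>\<^sub>0 rs) k" "\<sigma> ?c = n" "\<forall>i<m. \<sigma> i = \<sigma>\<^sub>0 i" for \<sigma>\<^sub>0 \<sigma> n k
    using realizesD(4)[OF f, of \<sigma> k] map_rs[OF that(3)] that(1,2) by (simp del: map_eq_conv)
  have exec_body: "exec body \<sigma> \<tau> \<longleftrightarrow> exec p (\<sigma>(?c' := Suc (\<sigma> ?c), ?c := Suc (\<sigma> ?c))) \<tau>" for \<sigma> \<tau>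
    by (simp add: body_def exec_Seq_iff exec_Assign_iff)
  have exec_prog: "exec prog \<sigma> \<sigma>' \<longleftrightarrow> (\<exists>\<tau> \<upsilon>. exec p (\<sigma>(?c := 0)) \<tau> \<and> exec loop \<tau> \<upsilon> \<and>
      \<sigma>' = \<upsilon>(out := \<upsilon> ?c))" for \<sigma> \<sigma>'
    by (simp add: prog_def exec_Seq_iff exec_Assign_iff)
  have step: "inv \<sigma>\<^sub>0 \<tau> \<and> \<tau> ?c = Suc (\<sigma> ?c)"
    if I: "inv \<sigma>\<^sub>0 \<sigma>" and y: "\<sigma> ?y = Suc n" and ex: "exec body (\<sigma>(?y := n)) \<tau>" for \<sigma>\<^sub>0 \<sigma> n \<tau>
  proof -
    have "computes f (Suc (\<sigma> ?c) # map \<sigma>\<^sub>0 rs) (\<tau> ?y) \<and> \<tau> ?c = Suc (\<sigma> ?c) \<and> (\<forall>i<m. \<tau> i = \<sigma>\<^sub>0 i)"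
      by (rule run_p[OF ex[unfolded exec_body]]) (use I in \<open>auto simp: inv_def\<close>)
    moreover have "\<exists>k. computes f (\<sigma> ?c # map \<sigma>\<^sub>0 rs) (Suc k)"
      using I y by (auto simp: inv_def)
    ultimately show ?thesis
      using I by (auto simp: inv_def less_Suc_eq)
  qed
  have init: "inv \<sigma>\<^sub>0 \<tau>" if "exec p (\<sigma>\<^sub>0(?c := 0)) \<tau>" for \<sigma>\<^sub>0 \<tau>
    using run_p[OF that, of 0 \<sigma>\<^sub>0] by (simp add: inv_def)
  have "realizes (Mu f) rs out m prog"
  proof (rule realizesI)
    show "wf_prog prog"
      using realizesD(1)[OF f] out by (simp add: prog_def loop_def body_def)
  next
    fix \<sigma> \<sigma>' assume "exec prog \<sigma> \<sigma>'"
    then obtain \<tau> \<upsilon> where *: "exec p (\<sigma>(?c := 0)) \<tau>" "exec loop \<tau> \<upsilon>" "\<sigma>' = \<upsilon>(out := \<upsilon> ?c)"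
      unfolding exec_prog by blast
    have "inv \<sigma> \<upsilon> \<and> \<upsilon> ?y = 0"
      by (rule Loop_sound[where I = "inv \<sigma>", OF *(2)[unfolded loop_def] init[OF *(1)]])
        (rule step[THEN conjunct1]; assumption)
    then show "computes (Mu f) (map \<sigma> rs) (\<sigma>' out)"
      and "\<And>i. i < m \<Longrightarrow> i \<noteq> out \<Longrightarrow> \<sigma>' i = \<sigma> i"
      using *(3) out by (auto simp: inv_def intro: computes.mu)
  next
    fix \<sigma> N assume "computes (Mu f) (map \<sigma> rs) N"
    then have N: "computes f (N # map \<sigma> rs) 0"
      and below: "\<And>j. j < N \<Longrightarrow> \<exists>k. computes f (j # map \<sigma> rs) (Suc k)"
      by (auto elim: computes_MuE)
    have defined: "\<exists>k. computes f (j # map \<sigma> rs) k" if "j \<le> N" for j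
    proof (cases "j = N")
      case True
      with N show ?thesis by blast
    next
      case False
      with below[of j] that show ?thesis by auto
    qed
    from defined[of 0] obtain k where "computes f (0 # map \<sigma> rs) k"
      by auto
    from run_p'[OF this, of "\<sigma>(?c := 0)"] obtain \<tau> where \<tau>: "exec p (\<sigma>(?c := 0)) \<tau>"
      by auto
    have "\<exists>\<upsilon>. exec loop \<tau> \<upsilon>"
      unfolding loop_def
    proof (rule Loop_complete[where I = "inv \<sigma>" and \<mu> = "\<lambda>\<sigma>. N - \<sigma> ?c"])
      show "inv \<sigma> \<tau>"
        by (rule init[OF \<tau>])
    next
      fix \<upsilon> n assume I: "inv \<sigma> \<upsilon>" and y: "\<upsilon> ?y = Suc n"
      \<comment> \<open>The search cannot overshoot: by the invariant \<open>f\<close> is positive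
        at all earlier candidates, whereas it is zero at \<open>N\<close>.\<close>
      have "\<not> N < \<upsilon> ?c"
      proof
        assume "N < \<upsilon> ?c"
        with I obtain k where "computes f (N # map \<sigma> rs) (Suc k)"
          unfolding inv_def by blast
        from computes_functional[OF N this] show False by simp
      qed
      moreover have "\<upsilon> ?c \<noteq> N"
      proof
        assume "\<upsilon> ?c = N"
        with I have "computes f (N # map \<sigma> rs) (\<upsilon> ?y)"
          by (simp add: inv_def)
        from computes_functional[OF N this] y show False by simp
      qed
      ultimately have less: "\<upsilon> ?c < N"
        by simp
      from defined[of "Suc (\<upsilon> ?c)"] less obtain k where k: "computes f (Suc (\<upsilon> ?c) # map \<sigma> rs) k"
        by auto
      let ?\<upsilon> = "\<upsilon>(?y := n)"
      have "\<exists>\<tau>. exec p (?\<upsilon>(?c' := Suc (?\<upsilon> ?c), ?c := Suc (?\<upsilon> ?c))) \<tau>"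
        by (rule run_p'[OF k]) (use I in \<open>auto simp: inv_def\<close>)
      then obtain \<tau>' where ex: "exec body (\<upsilon>(?y := n)) \<tau>'"
        unfolding exec_body by blast
      with step[OF I y ex] less
      show "\<exists>\<tau>'. exec body (\<upsilon>(?y := n)) \<tau>' \<and> inv \<sigma> \<tau>' \<and> N - \<tau>' ?c < N - \<upsilon> ?c"
        by auto
    qed
    then obtain \<upsilon> where "exec loop \<tau> \<upsilon>" ..
    with \<tau> have "exec prog \<sigma> (\<upsilon>(out := \<upsilon> ?c))"
      unfolding exec_prog by blast
    then show "\<exists>\<sigma>'. exec prog \<sigma> \<sigma>'" by blast
  qed
  then show ?thesis ..
qed

lemma recf_realizable: "realizable f"
proof (induction f)
  case Zero
  have "realizes Zero rs out m (Assign out Null)" for rs out m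
    by (rule realizesI) (auto simp: exec_Assign_iff intro: computes.zero)
  then show ?case
    unfolding realizable_def by blast
next
  case Succ
  have "\<exists>p. realizes Succ rs out m p" if "out \<notin> set rs" for rs out m
  proof (cases "\<exists>r. rs = [r]")
    case True
    then obtain r where rs: "rs = [r]" ..
    have "realizes Succ rs out m (Assign out (Next r))"
      by (rule realizesI) (use that rs in \<open>auto simp: exec_Assign_iff intro: computes.succ\<close>)
    then show ?thesis ..
  next
    case False
    show ?thesis
    proof (rule realizes_undefined)
      show "\<not> computes Succ (map \<sigma> rs) y" for \<sigma> y
        using False by (cases rs) (auto elim: computes_SuccE)
    qed
  qed
  then show ?case
    unfolding realizable_def by blast
next
  case (Proj i)
  have "\<exists>p. realizes (Proj i) rs out m p" if "out \<notin> set rs" for rs out m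
  proof (cases "i < length rs")
    case True
    have "realizes (Proj i) rs out m (Assign out (Same (rs ! i)))"
    proof (rule realizesI)
      show "wf_prog (Assign out (Same (rs ! i)))"
        using that True by auto
      show "computes (Proj i) (map \<sigma> rs) (\<sigma>' out)"
        if "exec (Assign out (Same (rs ! i))) \<sigma> \<sigma>'" for \<sigma> \<sigma>'
        using that True computes.proj[of i "map \<sigma> rs"] by (simp add: exec_Assign_iff)
    qed (auto simp: exec_Assign_iff)
    then show ?thesis ..
  next
    case False
    show ?thesis
      by (rule realizes_undefined) (use False in \<open>auto elim: computes_ProjE\<close>)
  qed
  then show ?case
    unfolding realizable_def by blast
next
  case (Comp f gs)
  then have "\<forall>g\<in>set gs. realizable g" by blast
  with realizes_Comp Comp.IH(1) show ?case
    unfolding realizable_def[of "Comp f gs"] by blast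
next
  case (Prec f g)
  have "\<exists>p. realizes (Prec f g) rs out m p" if rs: "set rs \<subseteq> {..<m}" and out: "out < m" for rs out m
  proof (cases rs)
    case Nil
    show ?thesis
      by (rule realizes_undefined) (use Nil in \<open>auto elim: computes_Prec_NilE\<close>)
  next
    case (Cons r rs')
    have *: "set rs' \<subseteq> {..<m + 5}" "set (m # (m + 1) # rs') \<subseteq> {..<m + 5}"
      "m + 1 \<notin> set rs'" "m + 3 \<notin> set (m # (m + 1) # rs')"
      using rs Cons by force+
    obtain p where p: "realizes f rs' (m + 1) (m + 5) p"
      using realizableE[OF Prec.IH(1) *(1) _ *(3)] by auto
    obtain q where q: "realizes g (m # (m + 1) # rs') (m + 3) (m + 5) q"
      using realizableE[OF Prec.IH(2) *(2) _ *(4)] by auto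
    show ?thesis
      unfolding Cons by (rule realizes_Prec[OF p q]) (use rs out Cons in auto)
  qed
  then show ?case
    unfolding realizable_def by blast
next
  case (Mu f)
  have "\<exists>p. realizes (Mu f) rs out m p" if rs: "set rs \<subseteq> {..<m}" and out: "out < m" for rs out m
  proof -
    have *: "set (m # rs) \<subseteq> {..<m + 3}" "m + 1 \<notin> set (m # rs)"
      using rs by force+
    obtain p where "realizes f (m # rs) (m + 1) (m + 3) p"
      using realizableE[OF Mu.IH *(1) _ *(2)] by auto
    then show ?thesis
      using rs out by (rule realizes_Mu)
  qed
  then show ?case
    unfolding realizable_def by blast
qed

section \<open>Computable functions\<close>

definition computable1 :: "(nat \<Rightarrow> nat) \<Rightarrow> bool" where
  "computable1 F \<longleftrightarrow> (\<exists>f. \<forall>x. computes f [x] (F x))"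

definition computable2 :: "(nat \<Rightarrow> nat \<Rightarrow> nat) \<Rightarrow> bool" where
  "computable2 F \<longleftrightarrow> (\<exists>f. \<forall>x y. computes f [x, y] (F x y))"

primrec const_recf :: "nat \<Rightarrow> recf" where
  "const_recf 0 = Zero"
| "const_recf (Suc k) = Comp Succ [const_recf k]"

lemma computes_Comp1: "computes g xs y \<Longrightarrow> computes f [y] z \<Longrightarrow> computes (Comp f [g]) xs z"
  by (rule computes.comp[where ys = "[y]"]) auto

lemma computes_Comp2:
  "computes g xs y \<Longrightarrow> computes g' xs y' \<Longrightarrow> computes f [y, y'] z \<Longrightarrow> computes (Comp f [g, g']) xs z"
  by (rule computes.comp[where ys = "[y, y']"]) auto

lemma computes_const_recf: "computes (const_recf k) xs k"
  by (induction k) (auto intro: computes.zero computes.succ computes_Comp1)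

lemma computable1_id: "computable1 (\<lambda>x. x)"
  unfolding computable1_def using computes.proj[of 0 "[_]"] by (intro exI[of _ "Proj 0"]) simp

lemma computable1_const: "computable1 (\<lambda>_. k)"
  unfolding computable1_def using computes_const_recf by blast

lemma computable1_Suc: "computable1 Suc"
  unfolding computable1_def using computes.succ by blast

lemma computable2_fst: "computable2 (\<lambda>x y. x)"
  unfolding computable2_def using computes.proj[of 0 "[_, _]"] by (intro exI[of _ "Proj 0"]) simp

lemma computable2_snd: "computable2 (\<lambda>x y. y)"
  unfolding computable2_def using computes.proj[of 1 "[_, _]"] by (intro exI[of _ "Proj 1"]) simp

lemma computable2_comp1:
  assumes "computable1 H" "computable2 F"
  shows "computable2 (\<lambda>x y. H (F x y))"
proof -
  from assms obtain h f where "\<forall>x. computes h [x] (H x)" "\<forall>x y. computes f [x, y] (F x y)"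
    unfolding computable1_def computable2_def by blast
  then have "computes (Comp h [f]) [x, y] (H (F x y))" for x y
    by (intro computes_Comp1[of f _ "F x y"]) simp_all
  then show ?thesis
    unfolding computable2_def by blast
qed

lemma computable1_comp2:
  assumes "computable2 H" "computable1 F" "computable1 G"
  shows "computable1 (\<lambda>x. H (F x) (G x))"
proof -
  from assms obtain h f g where "\<forall>x y. computes h [x, y] (H x y)" "\<forall>x. computes f [x] (F x)"
    "\<forall>x. computes g [x] (G x)"
    unfolding computable1_def computable2_def by blast
  then have "computes (Comp h [f, g]) [x] (H (F x) (G x))" for x
    by (intro computes_Comp2[of f _ "F x" g "G x"]) simp_all
  then show ?thesis
    unfolding computable1_def by blast
qed

lemma computable2_comp2:
  assumes "computable2 H" "computable2 F" "computable2 G"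
  shows "computable2 (\<lambda>x y. H (F x y) (G x y))"
proof -
  from assms obtain h f g where "\<forall>x y. computes h [x, y] (H x y)" "\<forall>x y. computes f [x, y] (F x y)"
    "\<forall>x y. computes g [x, y] (G x y)"
    unfolding computable2_def by blast
  then have "computes (Comp h [f, g]) [x, y] (H (F x y) (G x y))" for x y
    by (intro computes_Comp2[of f _ "F x y" g "G x y"]) simp_all
  then show ?thesis
    unfolding computable2_def by blast
qed

text \<open>The start value is hardwired as a constant, so only the step has to be computed.\<close>

lemma computable1_rec:
  assumes "computable2 G" "\<And>n. F (Suc n) = G n (F n)"
  shows "computable1 F"
proof -
  from assms(1) obtain g where g: "\<forall>x y. computes g [x, y] (G x y)"
    unfolding computable2_def by blast
  have "computes (Prec (const_recf (F 0)) g) [n] (F n)" for n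
  proof (induction n)
    case 0
    show ?case by (intro computes.prec_0 computes_const_recf)
  next
    case (Suc n)
    show ?case
      by (rule computes.prec_Suc[OF Suc]) (simp add: assms(2) g)
  qed
  then show ?thesis
    unfolding computable1_def by blast
qed

lemma computable2_add: "computable2 (+)"
proof -
  have "computes (Prec (Proj 0) (Comp Succ [Proj 1])) [x, y] (x + y)" for x y
  proof (induction x)
    case 0
    show ?case using computes.proj[of 0 "[y]"] by (intro computes.prec_0) simp
  next
    case (Suc x)
    have "computes (Proj 1) [x, x + y, y] (x + y)"
      using computes.proj[of 1 "[x, x + y, y]"] by simp
    then have "computes (Comp Succ [Proj 1]) [x, x + y, y] (Suc (x + y))"
      by (rule computes_Comp1) (rule computes.succ)
    with computes.prec_Suc[OF Suc] show ?case by simp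
  qed
  then show ?thesis
    unfolding computable2_def by blast
qed

lemma computable2_prod_encode: "computable2 (\<lambda>m n. prod_encode (m, n))"
proof -
  have "computable2 (\<lambda>n t. t + Suc n)"
    by (intro computable2_comp2[OF computable2_add] computable2_snd computable2_fst
        computable2_comp1[OF computable1_Suc])
  then have "computable1 triangle"
    by (rule computable1_rec) simp
  then have "computable2 (\<lambda>m n. triangle (m + n) + m)"
    by (intro computable2_comp2[OF computable2_add] computable2_fst computable2_add
        computable2_comp1[of triangle])
  then show ?thesis
    by (simp add: prod_encode_def)
qed

text \<open>
  If \<open>n\<close> is the number of \<open>\<alpha>\<close>, then the value at \<open>n\<close> is the number of \<open>input_regex n \<alpha>\<close>.
\<close>

lemma computable1_input_code:
  assumes "a \<noteq> b"
  shows "computable1 (\<lambda>n. prod_encode (4, prod_encode (prod_encode (4, prod_encode (prod_encode (2, cd a),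
     prod_encode (4, prod_encode (prod_encode (7, prod_encode (0, regex_code cd (num_regex a b n))),
       prod_encode (3, 0))))), n)))"
proof -
  \<comment> \<open>One step of \<open>num_regex\<close> on the level of numbers: the tags 4 and 2
    stand for \<open>Cat\<close> and \<open>Sym\<close>, and \<open>cd a\<close> enters as a
    constant.\<close>
  have "computable2 (\<lambda>n c. prod_encode (4, prod_encode (prod_encode (2, cd a), c)))"
    by (intro computable2_comp1[of "\<lambda>c. prod_encode (4, prod_encode (prod_encode (2, cd a), c))"]
        computable1_comp2[OF computable2_prod_encode] computable1_const computable1_id computable2_snd)
  then have "computable1 (\<lambda>n. regex_code cd (num_regex a b n))"
    by (rule computable1_rec) (simp add: num_regex.simps[OF assms])
  then show ?thesis
    by (intro computable1_comp2[OF computable2_prod_encode] computable1_const computable1_id)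
qed

text \<open>
  On the number \<open>n\<close> of a regex \<open>\<alpha>\<close>, the partial function \<open>Mu g\<close> below is defined iff the assumed
  decision procedure finds that \<open>input_regex n \<alpha>\<close> and \<open>check_regex\<close> have no word in common.  The
  contradiction arises for the regex \<open>\<alpha>\<close> of a program for \<open>Mu g\<close> itself.
\<close>

theorem theorem9:
  fixes cd :: "'a::finite \<Rightarrow> nat"
  assumes "CARD('a) \<ge> 2" and "inj cd"
  shows "\<not> decidable_on
           {(\<alpha>, \<beta>). deterministic_regex \<alpha> \<and> deterministic_regex \<beta>}
           (regex_pair_code cd)
           (\<lambda>(\<alpha>, \<beta>). lang \<alpha> \<inter> lang \<beta> = {})"
proof
  assume "decidable_on {(\<alpha>, \<beta>). deterministic_regex \<alpha> \<and> deterministic_regex \<beta>}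
    (regex_pair_code cd) (\<lambda>(\<alpha>, \<beta>). lang \<alpha> \<inter> lang \<beta> = {})"
  then obtain f where f:
    "computes f [regex_code cd \<alpha>, regex_code cd \<beta>] (if lang \<alpha> \<inter> lang \<beta> = {} then 1 else 0)"
    if "deterministic_regex \<alpha>" "deterministic_regex \<beta>" for \<alpha> \<beta>
    unfolding decidable_on_def regex_pair_code_def by fastforce
  obtain a b :: 'a where ab: "a \<noteq> b"
    using assms(1) by (metis UNIV_I card_le_Suc0_iff_eq finite not_less_eq_eq numeral_2_eq_2)
  obtain c where c: "computes c [n] (prod_encode (4, prod_encode (prod_encode (4,
      prod_encode (prod_encode (2, cd a), prod_encode (4, prod_encode (prod_encode (7, prod_encode (0,
        regex_code cd (num_regex a b n))), prod_encode (3, 0))))), n)))" for n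
    using computable1_input_code[OF ab, of cd] unfolding computable1_def by blast
  let ?check = "check_regex a b"
  \<comment> \<open>The assumed procedure may diverge on numbers of inadmissible regex;
    \<open>d\<close> is only evaluated at the \<open>n\<close> fixed below.\<close>
  define d where "d = Comp f [c, const_recf (regex_code cd ?check)]"
  define not0 where "not0 = Prec (const_recf 1) Zero"
  \<comment> \<open>\<open>Proj 1\<close> ignores the search variable, so the search stops at once
    or never. The answer 1 for an empty intersection becomes 0, which stops it.\<close>
  define g where "g = Comp not0 [Comp d [Proj 1]]"
  \<comment> \<open>Input in register \<open>0\<close>, as in the initial store of
    \<open>halting_iff_intersection\<close>; result in \<open>1\<close>, scratch from
    \<open>2\<close> on.\<close>
  obtain p where p: "realizes (Mu g) [0] 1 2 p"
    by (rule realizableE[OF recf_realizable, of "[0]" 2 1 "Mu g"]) auto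
  obtain k where k: "regs p \<subseteq> {..k}"
    using finite_regs finite_nat_set_iff_bounded_le[of "regs p"] by auto
  define \<alpha> where "\<alpha> = zeroing_regex a b k (prog_regex a b p)"
  \<comment> \<open>Self-application without circularity: \<open>\<alpha>\<close> depends only on
    \<open>p\<close> and \<open>k\<close>, and its number is supplied as input afterwards.\<close>
  define n where "n = regex_code cd \<alpha>"
  define empty where "empty \<longleftrightarrow> lang (input_regex a b n \<alpha>) \<inter> lang ?check = {}"
  let ?\<sigma> = "(\<lambda>_. 0)(0 := n)"
  have code: "computes c [n] (regex_code cd (input_regex a b n \<alpha>))"
    using c[of n] by (simp add: input_regex_def[OF ab] n_def)
  have "computes f [regex_code cd (input_regex a b n \<alpha>), regex_code cd ?check] (if empty then 1 else 0)"
    unfolding empty_def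
    by (rule f)
      (auto simp: \<alpha>_def intro: deterministic_input_regex[OF ab] deterministic_check_regex[OF ab] realizesD(1)[OF p])
  then have d: "computes d [n] (if empty then 1 else 0)"
    unfolding d_def using code computes_const_recf by (intro computes_Comp2)
  have not0: "computes not0 [x] (if x = 0 then 1 else 0)" for x
  proof (induction x)
    case 0
    have "computes not0 [0] 1"
      unfolding not0_def by (intro computes.prec_0 computes_const_recf)
    then show ?case by simp
  next
    case (Suc x)
    then have "computes not0 [Suc x] 0"
      unfolding not0_def by (rule computes.prec_Suc) (rule computes.zero)
    then show ?case by simp
  qed
  have g: "computes g [i, n] (if empty then 0 else 1)" for i
  proof -
    have "computes (Proj 1) [i, n] n"
      using computes.proj[of 1 "[i, n]"] by simp
    then have "computes (Comp d [Proj 1]) [i, n] (if empty then 1 else 0)"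
      using d by (rule computes_Comp1)
    from computes_Comp1[OF this not0] show ?thesis
      unfolding g_def by (cases empty) auto
  qed
  have "(\<exists>y. computes (Mu g) [n] y) \<longleftrightarrow> empty"
  proof
    assume "\<exists>y. computes (Mu g) [n] y"
    then obtain y where "computes g [y, n] 0"
      by (auto elim: computes_MuE)
    with g[of y] show empty
      by (auto dest: computes_functional split: if_splits)
  next
    assume empty
    with g[of 0] have "computes g [0, n] 0"
      by simp
    then have "computes (Mu g) [n] 0"
      by (rule computes.mu) simp
    then show "\<exists>y. computes (Mu g) [n] y" ..
  qed
  moreover have "(\<exists>y. computes (Mu g) [n] y) \<longleftrightarrow> (\<exists>\<sigma>. exec p ?\<sigma> \<sigma>)"
    using realizesD(2)[OF p, of ?\<sigma>] realizesD(4)[OF p, of ?\<sigma>] by auto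
  moreover have "\<not> empty \<longleftrightarrow> (\<exists>\<sigma>. exec p ?\<sigma> \<sigma>)"
    unfolding empty_def \<alpha>_def by (rule halting_iff_intersection[OF ab k])
  \<comment> \<open>An empty intersection would make \<open>Mu g\<close> defined at
    \<open>n\<close>, hence \<open>p\<close> halt, hence the intersection nonempty; and
    conversely.\<close>
  ultimately show False
    by blast
qed

end
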